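(* Let $f:\mathbb{R}^3\to\mathcal{G}_3$ be a multivector-valued function which has the Clifford Fourier transform $\mathcal{F}\{f\}(\omega)$. Assume $\int_{\mathbb{R}^3}\|f(x)\|^2\,d^3x=F<\infty$. Then $$\int_{\mathbb{R}^3}x^2\,\|f(x)\|^2\,d^3x\;\int_{\mathbb{R}^3}\omega^2\,\|\mathcal{F}\{f\}(\omega)\|^2\,d^3\omega\;\geq\;3\,\frac{(2\pi)^3}{4}\,F^2 ,$$ where $x^2=x\cdot x$ and $\omega^2=\omega\cdot\omega$ are the squared Euclidean lengths of the vectors $x,\omega\in\mathbb{R}^3$.
   Context: $\mathcal{G}_3=Cl_{3,0}$ is the real Clifford (geometric) algebra of Euclidean space $\mathbb{R}^3$ with orthonormal basis $e_1,e_2,e_3$: the associative unital $\mathbb{R}$-algebra generated by $e_1,e_2,e_3$ with $e_k^2=1$ and $e_je_k=-e_ke_j$ for $j\ne k$. It has the $8$-element real basis $\{e_A\}=\{1,e_1,e_2,e_3,e_{12},e_{31},e_{23},e_{123}\}$, where $e_{jk}=e_je_k$ and $e_{123}=e_1e_2e_3$. For $M=\sum_A\alpha_Ae_A$ with $\alpha_A\in\mathbb{R}$, $\|M\|^2=\langle M\widetilde{M}\rangle=\sum_A\alpha_A^2$, where $\widetilde{M}$ is the reverse of $M$ and $\langle\cdot\rangle$ is the scalar part. Put $i_3=e_{123}$; it satisfies $i_3^2=-1$ and commutes with every element of $\mathcal{G}_3$, and $e^{i_3t}=\cos t+i_3\sin t$ for $t\in\mathbb{R}$. The dot denotes the Euclidean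 inner product on $\mathbb{R}^3$, and $d^3x$, $d^3\omega$ denote Lebesgue measure. The Clifford Fourier transform (CFT) of $f:\mathbb{R}^3\to\mathcal{G}_3$ is the function $\mathcal{F}\{f\}:\mathbb{R}^3\to\mathcal{G}_3$ given by $$\mathcal{F}\{f\}(\omega)=\int_{\mathbb{R}^3}f(x)\,e^{-i_3\,\omega\cdot x}\,d^3x ,$$ understood in the usual $L^2$ (Plancherel) sense when $f\in L^2$ is not integrable. The integrals on the left of the inequality take values in $[0,\infty]$, with the convention $0\cdot\infty=0$. *)

theory Defs
  imports "HOL-Analysis.Analysis"
begin

text \<open>
  The Clifford algebra of Euclidean 3-space.  A multivector is given by its eight real coefficients
  with respect to the basis $1, e_1, e_2, e_3, e_{12}, e_{31}, e_{23}, e_{123}$; note that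
  the sixth element is $e_{31} = e_3 e_1 = - e_1 e_3$.
\<close>

datatype g3 =
  G3 (cf0: real) (cf1: real) (cf2: real) (cf3: real) (cf12: real) (cf31: real) (cf23: real) (cf123: real)

lemma g3_eq_iff:
  "a = b \<longleftrightarrow> cf0 a = cf0 b \<and> cf1 a = cf1 b \<and> cf2 a = cf2 b \<and> cf3 a = cf3 b \<and> cf12 a = cf12 b \<and> cf31 a = cf31 b \<and> cf23 a = cf23 b \<and> cf123 a = cf123 b"
  by (cases a; cases b) simp

instantiation g3 :: "{zero, one, plus, minus, uminus, times, scaleR}"
begin

definition "0 = G3 0 0 0 0 0 0 0 0"

definition "1 = G3 1 0 0 0 0 0 0 0"

definition "a + b = G3 (cf0 a + cf0 b) (cf1 a + cf1 b) (cf2 a + cf2 b) (cf3 a + cf3 b) (cf12 a + cf12 b) (cf31 a + cf31 b) (cf23 a + cf23 b) (cf123 a + cf123 b)"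

definition "a - b = G3 (cf0 a - cf0 b) (cf1 a - cf1 b) (cf2 a - cf2 b) (cf3 a - cf3 b) (cf12 a - cf12 b) (cf31 a - cf31 b) (cf23 a - cf23 b) (cf123 a - cf123 b)"

definition "- a = G3 (- cf0 a) (- cf1 a) (- cf2 a) (- cf3 a) (- cf12 a) (- cf31 a) (- cf23 a) (- cf123 a)"

definition "r *\<^sub>R a = G3 (r * cf0 a) (r * cf1 a) (r * cf2 a) (r * cf3 a) (r * cf12 a) (r * cf31 a) (r * cf23 a) (r * cf123 a)"

text \<open>
  The geometric product: the bilinear extension of the products of basis elements, obtained from
  $e_k^2 = 1$ and $e_j e_k = - e_k e_j$ for $j \neq k$.
\<close>

definition
  "a * b = G3
      (cf0 a * cf0 b + cf1 a * cf1 b + cf2 a * cf2 b + cf3 a * cf3 b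
       - cf12 a * cf12 b - cf31 a * cf31 b - cf23 a * cf23 b - cf123 a * cf123 b)
      (cf0 a * cf1 b + cf1 a * cf0 b - cf2 a * cf12 b + cf3 a * cf31 b
       + cf12 a * cf2 b - cf31 a * cf3 b - cf23 a * cf123 b - cf123 a * cf23 b)
      (cf0 a * cf2 b + cf1 a * cf12 b + cf2 a * cf0 b - cf3 a * cf23 b
       - cf12 a * cf1 b - cf31 a * cf123 b + cf23 a * cf3 b - cf123 a * cf31 b)
      (cf0 a * cf3 b - cf1 a * cf31 b + cf2 a * cf23 b + cf3 a * cf0 b
       - cf12 a * cf123 b + cf31 a * cf1 b - cf23 a * cf2 b - cf123 a * cf12 b)
      (cf0 a * cf12 b + cf1 a * cf2 b - cf2 a * cf1 b + cf3 a * cf123 b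
       + cf12 a * cf0 b + cf31 a * cf23 b - cf23 a * cf31 b + cf123 a * cf3 b)
      (cf0 a * cf31 b - cf1 a * cf3 b + cf2 a * cf123 b + cf3 a * cf1 b
       - cf12 a * cf23 b + cf31 a * cf0 b + cf23 a * cf12 b + cf123 a * cf2 b)
      (cf0 a * cf23 b + cf1 a * cf123 b + cf2 a * cf3 b - cf3 a * cf2 b
       + cf12 a * cf31 b - cf31 a * cf12 b + cf23 a * cf0 b + cf123 a * cf1 b)
      (cf0 a * cf123 b + cf1 a * cf23 b + cf2 a * cf31 b + cf3 a * cf12 b
       + cf12 a * cf3 b + cf31 a * cf2 b + cf23 a * cf1 b + cf123 a * cf0 b)"

instance ..

end

lemmas g3_arith_defs =
  zero_g3_def one_g3_def plus_g3_def minus_g3_def uminus_g3_def scaleR_g3_def times_g3_def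

instance g3 :: real_algebra_1
proof
qed (simp_all add: g3_arith_defs algebra_simps)

text \<open>
  The norm $\|M\|^2 = \sum_A \alpha_A^2$ comes from an inner product but is not submultiplicative,
  so there is no instance of the class of real normed algebras.
\<close>

instantiation g3 :: real_inner
begin

definition inner_g3 :: "g3 \<Rightarrow> g3 \<Rightarrow> real" where
  "inner_g3 a b = cf0 a * cf0 b + cf1 a * cf1 b + cf2 a * cf2 b + cf3 a * cf3 b + cf12 a * cf12 b + cf31 a * cf31 b + cf23 a * cf23 b + cf123 a * cf123 b"

definition norm_g3 :: "g3 \<Rightarrow> real" where
  "norm_g3 a = sqrt (inner a a)"

definition sgn_g3 :: "g3 \<Rightarrow> g3" where
  "sgn_g3 a = a /\<^sub>R norm a"

definition dist_g3 :: "g3 \<Rightarrow> g3 \<Rightarrow> real" where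
  "dist_g3 a b = norm (a - b)"

definition uniformity_g3 :: "(g3 \<times> g3) filter" where
  "uniformity_g3 = (INF e\<in>{0<..}. principal {(x, y). dist x y < e})"

definition open_g3 :: "g3 set \<Rightarrow> bool" where
  "open_g3 U \<longleftrightarrow> (\<forall>x\<in>U. eventually (\<lambda>(x', y). x' = x \<longrightarrow> y \<in> U) uniformity)"

instance
proof
  fix a :: g3
  show "0 \<le> inner a a"
    by (simp add: inner_g3_def)
  show "inner a a = 0 \<longleftrightarrow> a = 0"
    by (cases a) (auto simp: inner_g3_def zero_g3_def add_nonneg_eq_0_iff)
qed (simp_all add: dist_g3_def sgn_g3_def norm_g3_def uniformity_g3_def open_g3_def inner_g3_def
      g3_arith_defs algebra_simps)

end

definition e1 :: g3 where "e1 = G3 0 1 0 0 0 0 0 0"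
definition e2 :: g3 where "e2 = G3 0 0 1 0 0 0 0 0"
definition e3 :: g3 where "e3 = G3 0 0 0 1 0 0 0 0"
definition i3 :: g3 where "i3 = e1 * e2 * e3"

lemmas g3_basis_defs = e1_def e2_def e3_def i3_def

lemma i3_eq: "i3 = G3 0 0 0 0 0 0 0 1"
  by (simp add: g3_basis_defs g3_arith_defs)

instantiation g3 :: euclidean_space
begin

definition "Basis = {1, e1, e2, e3, e1 * e2, e3 * e1, e2 * e3, i3}"

instance
proof
  fix a :: g3
  show "(\<forall>u\<in>Basis. inner a u = 0) \<longleftrightarrow> a = 0"
    by (cases a) (auto simp: Basis_g3_def inner_g3_def g3_basis_defs g3_arith_defs)
qed (auto simp: Basis_g3_def inner_g3_def g3_basis_defs g3_arith_defs)

end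

lemma g3_relations:
  "e1 * e1 = 1" "e2 * e2 = 1" "e3 * e3 = 1"
  "e2 * e1 = - (e1 * e2)" "e3 * e1 = - (e1 * e3)" "e3 * e2 = - (e2 * e3)"
  by (simp_all add: g3_basis_defs g3_arith_defs)

lemma g3_expansion:
  "M = cf0 M *\<^sub>R 1 + cf1 M *\<^sub>R e1 + cf2 M *\<^sub>R e2 + cf3 M *\<^sub>R e3
     + cf12 M *\<^sub>R (e1 * e2) + cf31 M *\<^sub>R (e3 * e1) + cf23 M *\<^sub>R (e2 * e3) + cf123 M *\<^sub>R i3"
  by (cases M) (simp add: g3_basis_defs g3_arith_defs)

lemma i3_square: "i3 * i3 = - 1"
  by (simp add: g3_basis_defs g3_arith_defs)

lemma i3_central: "i3 * M = M * i3"
  by (cases M) (simp add: g3_basis_defs g3_arith_defs)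

definition g3_reverse :: "g3 \<Rightarrow> g3" where
  "g3_reverse M = G3 (cf0 M) (cf1 M) (cf2 M) (cf3 M) (- cf12 M) (- cf31 M) (- cf23 M) (- cf123 M)"

lemma g3_reverse_mult: "g3_reverse (M * N) = g3_reverse N * g3_reverse M"
  by (simp add: g3_reverse_def times_g3_def algebra_simps)

lemma norm_g3_square_eq_scalar_part: "(norm (M::g3))\<^sup>2 = cf0 (M * g3_reverse M)"
  unfolding power2_norm_eq_inner by (simp add: inner_g3_def g3_reverse_def times_g3_def)

text \<open>The exponential $e^{i_3 t}$.\<close>

definition exp_i3 :: "real \<Rightarrow> g3" where
  "exp_i3 t = cos t *\<^sub>R 1 + sin t *\<^sub>R i3"

definition cft :: "(real ^ 3 \<Rightarrow> g3) \<Rightarrow> real ^ 3 \<Rightarrow> g3" where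
  "cft f \<omega> = (LINT x|lebesgue. f x * exp_i3 (- (\<omega> \<bullet> x)))"

definition square_integrable :: "(real ^ 3 \<Rightarrow> g3) \<Rightarrow> bool" where
  "square_integrable f \<longleftrightarrow>
     f \<in> borel_measurable lebesgue \<and> (\<integral>\<^sup>+x. ennreal ((norm (f x))\<^sup>2) \<partial>lebesgue) < \<infinity>"

definition L2_tendsto :: "(nat \<Rightarrow> real ^ 3 \<Rightarrow> g3) \<Rightarrow> (real ^ 3 \<Rightarrow> g3) \<Rightarrow> bool" where
  "L2_tendsto \<phi> f \<longleftrightarrow>
     (\<lambda>n. \<integral>\<^sup>+x. ennreal ((norm (\<phi> n x - f x))\<^sup>2) \<partial>lebesgue) \<longlonglongrightarrow> 0"

text \<open>
  The Plancherel extension: \<open>g\<close> is the value at \<open>f\<close> of the $L^2$-continuous extension of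
  \<^const>\<open>cft\<close> from $L^1 \cap L^2$.
\<close>

definition has_plancherel_cft :: "(real ^ 3 \<Rightarrow> g3) \<Rightarrow> (real ^ 3 \<Rightarrow> g3) \<Rightarrow> bool" where
  "has_plancherel_cft f g \<longleftrightarrow>
     square_integrable f \<and> square_integrable g \<and>
     (\<exists>\<phi>. (\<forall>n. integrable lebesgue (\<phi> n) \<and> square_integrable (\<phi> n)) \<and>
          L2_tendsto \<phi> f \<and> L2_tendsto (\<lambda>n. cft (\<phi> n)) g)"

text \<open>
  \<open>g\<close> is the Clifford Fourier transform of \<open>f\<close>.  This is a relation because the Plancherel
  transform is determined only up to a null set; on $L^1 \cap L^2$ the two alternatives agree
  almost everywhere.
\<close>

definition has_cft :: "(real ^ 3 \<Rightarrow> g3) \<Rightarrow> (real ^ 3 \<Rightarrow> g3) \<Rightarrow> bool" where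
  "has_cft f g \<longleftrightarrow> integrable lebesgue f \<and> g = cft f \<or> has_plancherel_cft f g"

end

theory Submission
  imports Defs "HOL-Probability.Characteristic_Functions"
begin

text \<open>
  Translations replace derivatives.  Since $x_k \,(|f(x)|^2 - |f(x + s e_k)|^2)$ integrates to $s F$,
  the Cauchy--Schwarz inequality bounds $F$ by $2 \|x_k f\|$ times the norm of the difference quotient
  $(f(\cdot + s e_k) - f) / s$, up to a term that vanishes with $s$.  The transform of the difference is
  $g(\omega)\,(e^{i_3 s \omega_k} - 1)$, of norm at most $|s \omega_k|\, \|g(\omega)\|$, so Plancherel gives
  $F^2 \le 4 (2 \pi)^{-3} \|x_k f\|^2 \|\omega_k g\|^2$ for $k = 1, 2, 3$; the sum over $k$ is the claim.

  Only the inequality $(2 \pi)^3 \|u\|^2 \le \|\mathcal{F} u\|^2$ of the Plancherel theorem is needed.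
  For $u \in L^1 \cap L^2$ a Gaussian weight $e^{-|\delta \omega|^2 / 2}$ turns $\|\mathcal{F} u\|^2$ into a
  Gaussian average of the autocorrelation of $u$ at scale $\delta$, which tends to $(2 \pi)^3 \|u\|^2$
  as $\delta \to 0$ because translations are continuous in $L^2$.  The inequality then passes to
  $L^2$ limits.
\<close>

section \<open>Fourier transform of the Gaussian\<close>

text \<open>Nothing beyond square integrability is known of \<open>f\<close>, so the classical
  integration by parts would first require a weak derivative of \<open>f\<close> and control of
  boundary terms. A difference quotient exists for every \<open>f\<close>, the bound on its
  transform is pointwise in the frequency and holds for every \<open>s\<close>, and the limit
  \<open>s\<close> to 0 is taken at the very end, among real numbers. The Plancherel inequality has
  two uses: on translation differences for the estimate itself, and on \<open>f\<close> for the
  convention that 0 times infinity is 0, where a vanishing transform must force \<open>f\<close> to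
  vanish. The constant 3 counts directions. Each direction gives \<open>A b * B b\<close> at least
  (2 pi)^3 / 4 times F^2, and the sum of these three products is at most the product of the full
  second moments. Cauchy-Schwarz on the cross terms would give 9, so 3 is not sharp. The algebra
  enters through one fact: right multiplication by \<open>i3\<close> is an orthogonal complex
  structure, so the phases act as isometries although the norm is not submultiplicative.\<close>

lemma gaussian_fourier_real:
  fixes z :: real
  shows "integrable lborel (\<lambda>t. of_real (exp (- t\<^sup>2 / 2)) * cis (t * z))"
    and "(LINT t|lborel. of_real (exp (- t\<^sup>2 / 2)) * cis (t * z)) = of_real (sqrt (2 * pi) * exp (- z\<^sup>2 / 2))"
proof -
  have int: "integrable lborel (\<lambda>t. exp (- t\<^sup>2 / 2) :: real)"
  proof -
    have "integrable lborel (\<lambda>t. sqrt (2 * pi) * std_normal_density t)"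
      using integrable_normal_moment[of 1 0 0] by (intro integrable_mult_right) simp
    then show ?thesis by (simp add: std_normal_density_def)
  qed
  show "integrable lborel (\<lambda>t. of_real (exp (- t\<^sup>2 / 2)) * cis (t * z))"
    by (rule Bochner_Integration.integrable_bound[OF int]) (auto simp: norm_mult cis_conv_exp)
  \<comment> \<open>The integral is read off from the characteristic function of the standard normal
    law, whose density is this Gaussian divided by \<open>sqrt (2 * pi)\<close>.\<close>
  have "complex_of_real (exp (- z\<^sup>2 / 2)) = char std_normal_distribution z"
    by (simp add: char_std_normal_distribution)
  also have "\<dots> = (LINT t|lborel. std_normal_density t *\<^sub>R iexp (z * t))"
    unfolding char_def by (subst integral_density) auto
  also have "\<dots> = (LINT t|lborel. of_real (1 / sqrt (2 * pi)) * (of_real (exp (- t\<^sup>2 / 2)) * cis (t * z)))"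
    by (intro Bochner_Integration.integral_cong refl)
       (simp add: std_normal_density_def scaleR_conv_of_real cis_conv_exp mult_ac)
  also have "\<dots> = of_real (1 / sqrt (2 * pi)) * (LINT t|lborel. of_real (exp (- t\<^sup>2 / 2)) * cis (t * z))"
    by simp
  finally show "(LINT t|lborel. of_real (exp (- t\<^sup>2 / 2)) * cis (t * z)) = of_real (sqrt (2 * pi) * exp (- z\<^sup>2 / 2))"
    by (simp add: field_simps)
qed

text \<open>The integrand is a product of one-dimensional integrands in the coordinates, and
  \<open>lborel\<close> is the image of a product of lines, so both claims follow from the real case
  factor by factor.\<close>

lemma gaussian_fourier:
  fixes z :: "'a::euclidean_space"
  shows "integrable lborel (\<lambda>x. of_real (exp (- (norm x)\<^sup>2 / 2)) * cis (x \<bullet> z))"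
    and "(LINT x|lborel. of_real (exp (- (norm x)\<^sup>2 / 2)) * cis (x \<bullet> z))
         = of_real (sqrt (2 * pi) ^ DIM('a) * exp (- (norm z)\<^sup>2 / 2))"
proof -
  interpret product_sigma_finite "\<lambda>_::'a. lborel :: real measure" ..
  let ?f = "\<lambda>x::'a. complex_of_real (exp (- (norm x)\<^sup>2 / 2)) * cis (x \<bullet> z)"
  let ?T = "\<lambda>f::'a\<Rightarrow>real. \<Sum>b\<in>Basis. f b *\<^sub>R b"
  let ?P = "\<Pi>\<^sub>M b\<in>(Basis::'a set). (lborel::real measure)"
  have norm_eq: "(norm w)\<^sup>2 = (\<Sum>b\<in>Basis. (w \<bullet> b)\<^sup>2)" for w :: 'a
    unfolding power2_norm_eq_inner by (subst euclidean_inner) (simp add: power2_eq_square)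
  have cis_sum: "cis (sum h A) = (\<Prod>b\<in>A. cis (h b))" if "finite A" for h :: "'a \<Rightarrow> real" and A
    using that by (induction A rule: finite_induct) (simp_all flip: cis_mult)
  have comp: "?T f \<bullet> b = f b" if "b \<in> Basis" for f and b :: 'a
    using that by (simp add: inner_sum_left inner_Basis if_distrib sum.delta cong: if_cong)
  have f_T: "?f (?T f) = (\<Prod>b\<in>Basis. of_real (exp (- (f b)\<^sup>2 / 2)) * cis (f b * (z \<bullet> b)))" for f
  proof -
    have "(norm (?T f))\<^sup>2 = (\<Sum>b\<in>Basis. (f b)\<^sup>2)"
      unfolding norm_eq by (intro sum.cong) (auto simp: comp)
    moreover have "?T f \<bullet> z = (\<Sum>b\<in>Basis. f b * (z \<bullet> b))"
      by (simp add: inner_sum_left inner_commute[of z])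
    ultimately show ?thesis
      by (simp add: cis_sum exp_sum prod.distrib sum_negf sum_divide_distrib[symmetric]
        flip: of_real_prod) (simp add: sum_divide_distrib exp_sum flip: sum_negf)
  qed
  have meas: "?f \<in> borel_measurable borel"
    by (intro borel_measurable_continuous_onI continuous_intros) auto
  have mT: "?T \<in> measurable ?P borel" by measurable
  have "integrable ?P (\<lambda>f. \<Prod>b\<in>Basis. of_real (exp (- (f b)\<^sup>2 / 2)) * cis (f b * (z \<bullet> b)))"
    by (intro product_integrable_prod gaussian_fourier_real) simp
  then show "integrable lborel ?f"
    unfolding lborel_eq[where 'a='a] by (subst integrable_distr_eq[OF mT meas]) (simp only: f_T)
  have "integral\<^sup>L lborel ?f = (LINT f|(?P). (\<Prod>b\<in>Basis. of_real (exp (- (f b)\<^sup>2 / 2)) * cis (f b * (z \<bullet> b))))"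
    unfolding lborel_eq[where 'a='a] by (subst integral_distr[OF mT meas]) (simp only: f_T)
  also have "\<dots> = (\<Prod>b\<in>Basis. of_real (sqrt (2 * pi) * exp (- (z \<bullet> b)\<^sup>2 / 2)))"
    by (subst product_integral_prod) (simp_all only: gaussian_fourier_real finite_Basis)
  also have "\<dots> = of_real (sqrt (2 * pi) ^ DIM('a) * exp (- (norm z)\<^sup>2 / 2))"
    by (simp add: norm_eq prod.distrib exp_sum sum_divide_distrib flip: sum_negf)
  finally show "integral\<^sup>L lborel ?f = of_real (sqrt (2 * pi) ^ DIM('a) * exp (- (norm z)\<^sup>2 / 2))" .
qed

section \<open>Continuity of translations in $L^2$\<close>

lemma nn_integral_lborel_translate:
  fixes u :: "'a::euclidean_space \<Rightarrow> ennreal"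
  assumes [measurable]: "u \<in> borel_measurable borel"
  shows "(\<integral>\<^sup>+x. u (x + h) \<partial>lborel) = (\<integral>\<^sup>+x. u x \<partial>lborel)"
proof -
  have "(\<integral>\<^sup>+x. u x \<partial>lborel) = (\<integral>\<^sup>+x. u x \<partial>distr lborel borel ((+) h))"
    by (simp add: lborel_distr_plus)
  also have "\<dots> = (\<integral>\<^sup>+x. u (x + h) \<partial>lborel)"
    by (subst nn_integral_distr) (auto simp: add.commute)
  finally show ?thesis ..
qed

text \<open>Expanding the square of \<open>t *\<^sub>R a - b\<close> gives it. At
  \<open>t = 1\<close> it is the crude bound with factor 2; for \<open>t\<close> near 0 the factor
  on \<open>a\<close> tends to 1, which keeps constants exact when a bound passes to an $L^2$
  limit.\<close>

lemma norm_add_square_le: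
  fixes a b :: "'a::real_inner"
  assumes "t > 0"
  shows "(norm (a + b))\<^sup>2 \<le> (1 + t) * (norm a)\<^sup>2 + (1 + 1 / t) * (norm b)\<^sup>2"
proof -
  have "0 \<le> (norm (t *\<^sub>R a - b))\<^sup>2 / t"
    using assms by simp
  also have "\<dots> = t * (norm a)\<^sup>2 + (norm b)\<^sup>2 / t - 2 * (a \<bullet> b)"
    using assms unfolding power2_norm_eq_inner
    by (simp add: inner_diff_left inner_diff_right inner_commute[of b a] field_simps)
  finally show ?thesis
    unfolding power2_norm_eq_inner
    by (simp add: inner_add_left inner_add_right inner_commute[of b a] algebra_simps)
qed

lemma nn_integral_norm_add_square_le:
  fixes u v :: "'a \<Rightarrow> 'b::{real_inner, second_countable_topology}"
  assumes [measurable]: "u \<in> borel_measurable M" "v \<in> borel_measurable M" and "t > 0"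
  shows "(\<integral>\<^sup>+x. ennreal ((norm (u x + v x))\<^sup>2) \<partial>M)
    \<le> ennreal (1 + t) * (\<integral>\<^sup>+x. ennreal ((norm (u x))\<^sup>2) \<partial>M)
      + ennreal (1 + 1 / t) * (\<integral>\<^sup>+x. ennreal ((norm (v x))\<^sup>2) \<partial>M)"
proof -
  have "(\<integral>\<^sup>+x. ennreal ((norm (u x + v x))\<^sup>2) \<partial>M)
    \<le> (\<integral>\<^sup>+x. ennreal (1 + t) * ennreal ((norm (u x))\<^sup>2) + ennreal (1 + 1 / t) * ennreal ((norm (v x))\<^sup>2) \<partial>M)"
    using norm_add_square_le[OF \<open>t > 0\<close>] \<open>t > 0\<close>
    by (intro nn_integral_mono) (simp add: ennreal_leI flip: ennreal_mult ennreal_plus)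
  also have "\<dots> = ennreal (1 + t) * (\<integral>\<^sup>+x. ennreal ((norm (u x))\<^sup>2) \<partial>M)
      + ennreal (1 + 1 / t) * (\<integral>\<^sup>+x. ennreal ((norm (v x))\<^sup>2) \<partial>M)"
    by (simp add: nn_integral_add nn_integral_cmult)
  finally show ?thesis .
qed

section \<open>Approximation by continuous functions and translations in $L^2$\<close>

definition clip :: "real \<Rightarrow> 'a::real_normed_vector \<Rightarrow> 'a" where
  "clip N v = (N / max N (norm v)) *\<^sub>R v"

text \<open>Cut-off in space, as \<open>clip\<close> is a cut-off in value. Both are continuous:
  \<open>clip\<close> pushes long vectors onto the sphere of radius \<open>N\<close> instead of
  deleting them, and \<open>bump\<close> falls linearly from 1 to 0 between the radii
  \<open>N\<close> and \<open>N + 1\<close>.\<close>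

definition bump :: "real \<Rightarrow> 'a::real_normed_vector \<Rightarrow> real" where
  "bump N x = max 0 (min 1 (N + 1 - norm x))"

lemma clip_norm_le: "N > 0 \<Longrightarrow> norm (clip N v) \<le> N" "N > 0 \<Longrightarrow> norm (clip N v) \<le> norm v"
  by (auto simp: clip_def max_def field_simps divide_le_eq mult_left_mono mult_right_mono)

lemma continuous_clip: "N > 0 \<Longrightarrow> continuous_on A (clip N)"
  unfolding clip_def by (intro continuous_intros) (auto simp: max_def)

lemma bump_bounds: "0 \<le> bump N x" "bump N x \<le> 1" "norm x > N + 1 \<Longrightarrow> bump N x = 0"
  by (auto simp: bump_def)

lemma continuous_bump: "continuous_on A (bump N)"
  unfolding bump_def by (intro continuous_intros)

lemma borel_measurable_clip [measurable]:
  "N > 0 \<Longrightarrow> (clip N :: 'a::euclidean_space \<Rightarrow> 'a) \<in> borel_measurable borel"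
  by (intro borel_measurable_continuous_onI continuous_clip)

lemma borel_measurable_bump [measurable]: "bump N \<in> borel_measurable borel"
  by (intro borel_measurable_continuous_onI continuous_bump)

lemma norm_diff_square_le_4:
  fixes a b :: "'a::real_normed_vector"
  assumes "norm a \<le> r" "norm b \<le> r"
  shows "(norm (a - b))\<^sup>2 \<le> 4 * r\<^sup>2"
proof -
  have "norm (a - b) \<le> 2 * r"
    using norm_triangle_ineq4[of a b] assms by simp
  then have "(norm (a - b))\<^sup>2 \<le> (2 * r)\<^sup>2"
    by (intro power_mono) auto
  then show ?thesis by (simp add: power_mult_distrib)
qed

lemma nn_integral_square_dominated:
  fixes w :: "nat \<Rightarrow> 'a \<Rightarrow> 'b::euclidean_space"
  assumes [measurable]: "\<And>n. w n \<in> borel_measurable M" "d \<in> borel_measurable M"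
    and "\<And>n x. (norm (w n x))\<^sup>2 \<le> d x"
    and "(\<integral>\<^sup>+x. ennreal (d x) \<partial>M) < \<infinity>"
    and lim: "AE x in M. (\<lambda>n. w n x) \<longlonglongrightarrow> 0"
  shows "(\<lambda>n. \<integral>\<^sup>+x. ennreal ((norm (w n x))\<^sup>2) \<partial>M) \<longlonglongrightarrow> 0"
proof -
  have "(\<lambda>n. \<integral>\<^sup>+x. ennreal ((norm (w n x))\<^sup>2) \<partial>M) \<longlonglongrightarrow> (\<integral>\<^sup>+x. 0 \<partial>M)"
  proof (rule nn_integral_dominated_convergence[where w = "\<lambda>x. ennreal (d x)"])
    show "AE x in M. (\<lambda>n. ennreal ((norm (w n x))\<^sup>2)) \<longlonglongrightarrow> 0"
      using lim
    proof eventually_elim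
      case (elim x)
      have "(\<lambda>n. ennreal ((norm (w n x))\<^sup>2)) \<longlonglongrightarrow> ennreal ((norm (0::'b))\<^sup>2)"
        by (intro tendsto_intros elim)
      then show ?case by simp
    qed
  qed (use assms in \<open>auto simp: ennreal_leI\<close>)
  then show ?thesis by simp
qed

lemma nn_integral_cball_finite:
  "(\<integral>\<^sup>+x. ennreal (4 * (R * indicator (cball (0::'a::euclidean_space) S) x)\<^sup>2) \<partial>lborel) < \<infinity>"
proof -
  have "(\<integral>\<^sup>+x. ennreal (4 * (R * indicator (cball (0::'a) S) x)\<^sup>2) \<partial>lborel)
    = (\<integral>\<^sup>+x. ennreal (4 * R\<^sup>2) * indicator (cball (0::'a) S) x \<partial>lborel)"
    by (intro nn_integral_cong) (auto simp: indicator_def)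
  also have "\<dots> < \<infinity>"
    using emeasure_lborel_cball_finite[of "0::'a" S]
    by (simp add: nn_integral_cmult_indicator ennreal_mult_less_top)
  finally show ?thesis .
qed

text \<open>Two limits, because they need different dominating functions. Truncating
  \<open>u\<close> is dominated by \<open>u\<close> itself. The continuous functions that converge
  to \<open>u\<close> almost everywhere obey no common bound, so they are compared with
  \<open>u\<close> only after truncation, when a multiple of the indicator of a ball
  dominates.\<close>

lemma L2_approx_continuous:
  fixes u :: "'a::euclidean_space \<Rightarrow> 'b::euclidean_space"
  assumes [measurable]: "u \<in> borel_measurable borel"
    and fin: "(\<integral>\<^sup>+x. ennreal ((norm (u x))\<^sup>2) \<partial>lborel) < \<infinity>"
    and e: "0 < (e::real)"
  obtains c :: "'a \<Rightarrow> 'b" and R where "continuous_on UNIV c" "R > 0" "\<And>x. norm (c x) \<le> R"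
    "\<And>x. norm x > R \<Longrightarrow> c x = 0"
    "(\<integral>\<^sup>+x. ennreal ((norm (u x - c x))\<^sup>2) \<partial>lborel) < ennreal e"
proof -
  define v where "v n x = bump (real (Suc n)) x *\<^sub>R clip (real (Suc n)) (u x)" for n x
  have [measurable]: "v n \<in> borel_measurable borel" for n
    unfolding v_def by measurable
  have "(\<lambda>n. \<integral>\<^sup>+x. ennreal ((norm (u x - v n x))\<^sup>2) \<partial>lborel) \<longlonglongrightarrow> 0"
  proof (rule nn_integral_square_dominated[where d = "\<lambda>x. 4 * (norm (u x))\<^sup>2"])
    fix n x
    have "norm (v n x) \<le> 1 * norm (clip (real (Suc n)) (u x))"
      unfolding v_def norm_scaleR using bump_bounds[of "real (Suc n)" x]
      by (intro mult_right_mono) auto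
    also have "\<dots> \<le> norm (u x)" by (simp add: clip_norm_le)
    finally show "(norm (u x - v n x))\<^sup>2 \<le> 4 * (norm (u x))\<^sup>2"
      by (intro norm_diff_square_le_4) auto
  next
    show "(\<integral>\<^sup>+x. ennreal (4 * (norm (u x))\<^sup>2) \<partial>lborel) < \<infinity>"
      using fin by (simp add: ennreal_mult nn_integral_cmult ennreal_mult_less_top)
  next
    have "(\<lambda>n. u x - v n x) \<longlonglongrightarrow> 0" for x
    proof (rule tendsto_eventually)
      obtain N where N: "norm x + norm (u x) \<le> real N"
        using real_arch_simple by blast
      show "\<forall>\<^sub>F n in sequentially. u x - v n x = 0"
        using eventually_ge_at_top[of N]
      proof eventually_elim
        case (elim n)
        then have "norm x + norm (u x) \<le> real (Suc n)" using N by simp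
        then have "norm x \<le> real (Suc n)" "norm (u x) \<le> real (Suc n)"
          using norm_ge_zero[of x] norm_ge_zero[of "u x"] by linarith+
        then show ?case by (simp add: v_def bump_def clip_def max_def min_def)
      qed
    qed
    then show "AE x in lborel. (\<lambda>n. u x - v n x) \<longlonglongrightarrow> 0" by simp
  qed auto
  moreover have e4: "0 < ennreal (e / 4)" using e by simp
  ultimately have "\<forall>\<^sub>F n in sequentially. (\<integral>\<^sup>+x. ennreal ((norm (u x - v n x))\<^sup>2) \<partial>lborel) < ennreal (e / 4)"
    by (rule order_tendstoD(2))
  then obtain n where n: "(\<integral>\<^sup>+x. ennreal ((norm (u x - v n x))\<^sup>2) \<partial>lborel) < ennreal (e / 4)"
    by (auto simp: eventually_sequentially)
  \<comment> \<open>The bump vanishes only beyond radius \<open>Suc n + 1\<close>; this one number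
    then bounds the support and the values.\<close>
  define R where "R = real (Suc n) + 1"
  have "u \<in> borel_measurable lebesgue"
    by (rule measurable_completion) simp
  then have "u measurable_on UNIV"
    by (intro lebesgue_measurable_imp_measurable_on) simp_all
  then obtain N g where N: "negligible N" and g: "\<And>m. continuous_on UNIV (g m)"
    and g_lim: "\<And>x. x \<notin> N \<Longrightarrow> (\<lambda>m. g m x) \<longlonglongrightarrow> u x"
    unfolding measurable_on_def by auto
  \<comment> \<open>The approximants receive the same cut-offs as \<open>u\<close>. Since
    \<open>clip\<close> is continuous, they converge to \<open>v n\<close> wherever
    \<open>g m\<close> converges to \<open>u\<close>.\<close>
  define c where "c m x = bump (real (Suc n)) x *\<^sub>R clip (real (Suc n)) (g m x)" for m x
  have c_cont: "continuous_on UNIV (c m)" for m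
    unfolding c_def
    by (rule continuous_on_scaleR[OF continuous_bump continuous_on_compose2[OF continuous_clip g subset_UNIV]]) simp
  have c_le: "norm (c m x) \<le> bump (real (Suc n)) x * R" and v_le: "norm (v n x) \<le> bump (real (Suc n)) x * R" for m x
    unfolding v_def c_def R_def norm_scaleR
    using bump_bounds[of "real (Suc n)" x] clip_norm_le(1)[of "real (Suc n)"]
    by (auto intro!: mult_left_mono order_trans[OF clip_norm_le(1)])
  have [measurable]: "c m \<in> borel_measurable borel" for m
    by (rule borel_measurable_continuous_onI[OF c_cont])
  have bump_ind: "bump (real (Suc n)) x * R \<le> R * indicator (cball 0 R) x" for x :: 'a
    using bump_bounds[of "real (Suc n)" x] unfolding R_def
    by (auto simp: indicator_def)
  have [measurable]: "cball (0::'a) R \<in> sets borel"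
    by simp
  have "(\<lambda>m. \<integral>\<^sup>+x. ennreal ((norm (v n x - c m x))\<^sup>2) \<partial>lborel) \<longlonglongrightarrow> 0"
  proof (rule nn_integral_square_dominated[where d = "\<lambda>x. 4 * (R * indicator (cball 0 R) x)\<^sup>2"])
    show "(norm (v n x - c m x))\<^sup>2 \<le> 4 * (R * indicator (cball 0 R) x)\<^sup>2" for m x
      using c_le[of m x] v_le[of x] bump_ind[of x] by (intro norm_diff_square_le_4) auto
    show "(\<integral>\<^sup>+x. ennreal (4 * (R * indicator (cball (0::'a) R) x)\<^sup>2) \<partial>lborel) < \<infinity>"
      by (rule nn_integral_cball_finite)
    have "AE x in lborel. x \<notin> N"
      using AE_not_in[of N lebesgue] N by (simp add: negligible_iff_null_sets AE_completion_iff)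
    then show "AE x in lborel. (\<lambda>m. v n x - c m x) \<longlonglongrightarrow> 0"
    proof eventually_elim
      case (elim x)
      have "isCont (clip (real (Suc n))) (u x)"
        using continuous_clip[of "real (Suc n)" "UNIV :: 'b set"] by (simp add: continuous_on_eq_continuous_at)
      from isCont_tendsto_compose[OF this g_lim[OF elim]]
      have "(\<lambda>m. c m x) \<longlonglongrightarrow> v n x"
        unfolding c_def v_def by (intro tendsto_intros)
      then have "(\<lambda>m. v n x - c m x) \<longlonglongrightarrow> v n x - v n x" by (intro tendsto_intros)
      then show ?case by simp
    qed
  qed auto
  from order_tendstoD(2)[OF this e4] obtain m
    where m: "(\<integral>\<^sup>+x. ennreal ((norm (v n x - c m x))\<^sup>2) \<partial>lborel) < ennreal (e / 4)"
    by (auto simp: eventually_sequentially)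
  have "(\<integral>\<^sup>+x. ennreal ((norm (u x - c m x))\<^sup>2) \<partial>lborel)
      \<le> 2 * (\<integral>\<^sup>+x. ennreal ((norm (u x - v n x))\<^sup>2) \<partial>lborel)
       + 2 * (\<integral>\<^sup>+x. ennreal ((norm (v n x - c m x))\<^sup>2) \<partial>lborel)"
    using nn_integral_norm_add_square_le[of "\<lambda>x. u x - v n x" lborel "\<lambda>x. v n x - c m x" 1] by simp
  also have "\<dots> < 2 * ennreal (e / 4) + 2 * ennreal (e / 4)"
    using n m by (intro add_strict_mono ennreal_mult_strict_left_mono) auto
  also have "\<dots> = ennreal 2 * ennreal (e / 4) + ennreal 2 * ennreal (e / 4)" by simp
  also have "\<dots> = ennreal e"
    using e by (simp only: ennreal_mult'[symmetric] ennreal_plus[symmetric]) (simp flip: ennreal_plus ennreal_mult')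
  finally have "(\<integral>\<^sup>+x. ennreal ((norm (u x - c m x))\<^sup>2) \<partial>lborel) < ennreal e" .
  moreover have "norm (c m x) \<le> R" for x
    using order_trans[OF c_le bump_ind] by (rule order_trans) (auto simp: indicator_def R_def)
  moreover have "c m x = 0" if "norm x > R" for x
    using that by (auto simp: c_def R_def bump_bounds)
  ultimately show ?thesis
    using that[of "c m" R] c_cont by (auto simp: R_def)
qed

text \<open>For a continuous function of bounded support this is dominated convergence. Translation
  invariance makes the approximation error of the shifted function equal to that of
  \<open>u\<close>, uniformly in the shift, so the general case follows.\<close>

lemma L2_translation_continuous:
  fixes u :: "'a::euclidean_space \<Rightarrow> 'b::euclidean_space"
  assumes [measurable]: "u \<in> borel_measurable borel"
    and fin: "(\<integral>\<^sup>+x. ennreal ((norm (u x))\<^sup>2) \<partial>lborel) < \<infinity>"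
    and h: "h \<longlonglongrightarrow> 0"
  shows "(\<lambda>n. \<integral>\<^sup>+x. ennreal ((norm (u (x + h n) - u x))\<^sup>2) \<partial>lborel) \<longlonglongrightarrow> 0"
proof (rule order_tendstoI)
  fix a :: ennreal assume "0 < a"
  then obtain b where b: "0 < b" "b < a" using dense by blast
  then obtain e where e: "b = ennreal e" "e > 0" by (cases b) auto
  \<comment> \<open>Two uses of the squared triangle inequality cost a total factor of 2 + 2 * (2 +
    2) = 10.\<close>
  then have e10: "e / 10 > 0" by simp
  obtain c :: "'a \<Rightarrow> 'b" and R where c: "continuous_on UNIV c" "R > 0" "\<And>x. norm (c x) \<le> R"
    "\<And>x. norm x > R \<Longrightarrow> c x = 0"
    and uc: "(\<integral>\<^sup>+x. ennreal ((norm (u x - c x))\<^sup>2) \<partial>lborel) < ennreal (e / 10)"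
    by (rule L2_approx_continuous[OF assms(1) fin e10]) blast
  have [measurable]: "c \<in> borel_measurable borel"
    by (rule borel_measurable_continuous_onI[OF c(1)])
  \<comment> \<open>A convergent sequence of shifts is bounded, so the single ball of radius
    \<open>R + H\<close> contains the supports of \<open>c\<close> and of all its
    translates.\<close>
  obtain H where H: "\<And>n. norm (h n) \<le> H"
    using convergent_imp_Bseq[OF convergentI[OF h]] by (auto simp: Bseq_def)
  have [measurable]: "cball (0::'a) (R + H) \<in> sets borel"
    by simp
  have "(\<lambda>n. \<integral>\<^sup>+x. ennreal ((norm (c (x + h n) - c x))\<^sup>2) \<partial>lborel) \<longlonglongrightarrow> 0"
  proof (rule nn_integral_square_dominated[where d = "\<lambda>x. 4 * (R * indicator (cball 0 (R + H)) x)\<^sup>2"])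
    show "(norm (c (x + h n) - c x))\<^sup>2 \<le> 4 * (R * indicator (cball 0 (R + H)) x)\<^sup>2" for n x
    proof (rule norm_diff_square_le_4)
      have "norm x \<le> norm (x + h n) + norm (h n)"
        using norm_triangle_ineq4[of "x + h n" "h n"] by simp
      then show "norm (c (x + h n)) \<le> R * indicator (cball 0 (R + H)) x"
        using c(3)[of "x + h n"] c(4)[of "x + h n"] H[of n] by (auto simp: indicator_def)
      show "norm (c x) \<le> R * indicator (cball 0 (R + H)) x"
        using c(3)[of x] c(4)[of x] order_trans[OF norm_ge_zero H[of n]] by (auto simp: indicator_def)
    qed
    show "(\<integral>\<^sup>+x. ennreal (4 * (R * indicator (cball (0::'a) (R + H)) x)\<^sup>2) \<partial>lborel) < \<infinity>"
      by (rule nn_integral_cball_finite)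
    have "(\<lambda>n. c (x + h n) - c x) \<longlonglongrightarrow> 0" for x
    proof -
      have "isCont c (x + 0)" using c(1) by (simp add: continuous_on_eq_continuous_at)
      moreover have "(\<lambda>n. x + h n) \<longlonglongrightarrow> x + 0" by (intro tendsto_intros h)
      ultimately have "(\<lambda>n. c (x + h n)) \<longlonglongrightarrow> c (x + 0)" by (rule isCont_tendsto_compose)
      then have "(\<lambda>n. c (x + h n) - c x) \<longlonglongrightarrow> c (x + 0) - c x" by (intro tendsto_intros)
      then show ?thesis by simp
    qed
    then show "AE x in lborel. (\<lambda>n. c (x + h n) - c x) \<longlonglongrightarrow> 0" by simp
  qed auto
  moreover have "0 < ennreal (e / 10)" using e10 by simp
  ultimately have "\<forall>\<^sub>F n in sequentially. (\<integral>\<^sup>+x. ennreal ((norm (c (x + h n) - c x))\<^sup>2) \<partial>lborel) < ennreal (e / 10)"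
    by (rule order_tendstoD(2))
  then show "\<forall>\<^sub>F n in sequentially. (\<integral>\<^sup>+x. ennreal ((norm (u (x + h n) - u x))\<^sup>2) \<partial>lborel) < a"
  proof eventually_elim
    case (elim n)
    have 1: "(\<integral>\<^sup>+x. ennreal ((norm (u (x + h n) - c (x + h n)))\<^sup>2) \<partial>lborel) = (\<integral>\<^sup>+x. ennreal ((norm (u x - c x))\<^sup>2) \<partial>lborel)"
      by (rule nn_integral_lborel_translate[where u = "\<lambda>x. ennreal ((norm (u x - c x))\<^sup>2)"]) measurable
    have 2: "(\<integral>\<^sup>+x. ennreal ((norm (c (x + h n) - u x))\<^sup>2) \<partial>lborel)
      \<le> 2 * (\<integral>\<^sup>+x. ennreal ((norm (c (x + h n) - c x))\<^sup>2) \<partial>lborel)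
       + 2 * (\<integral>\<^sup>+x. ennreal ((norm (u x - c x))\<^sup>2) \<partial>lborel)"
      using nn_integral_norm_add_square_le[of "\<lambda>x. c (x + h n) - c x" lborel "\<lambda>x. c x - u x" 1]
      by (simp add: norm_minus_commute)
    have "(\<integral>\<^sup>+x. ennreal ((norm (u (x + h n) - u x))\<^sup>2) \<partial>lborel)
      \<le> 2 * (\<integral>\<^sup>+x. ennreal ((norm (u x - c x))\<^sup>2) \<partial>lborel)
       + 2 * (\<integral>\<^sup>+x. ennreal ((norm (c (x + h n) - u x))\<^sup>2) \<partial>lborel)"
      using nn_integral_norm_add_square_le[of "\<lambda>x. u (x + h n) - c (x + h n)" lborel "\<lambda>x. c (x + h n) - u x" 1]
      unfolding 1[symmetric] by simp
    also have "\<dots> \<le> 2 * ennreal (e / 10) + 2 * (2 * ennreal (e / 10) + 2 * ennreal (e / 10))"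
      using elim uc by (intro add_mono mult_left_mono order_trans[OF 2]) auto
    also have "\<dots> = ennreal 2 * ennreal (e / 10) + ennreal 2 * (ennreal 2 * ennreal (e / 10) + ennreal 2 * ennreal (e / 10))" by simp
    also have "\<dots> = ennreal e"
      using e10 by (simp only: ennreal_mult'[symmetric] ennreal_plus[symmetric]) (simp flip: ennreal_plus ennreal_mult')
    also have "\<dots> < a" using b e by simp
    finally show ?case .
  qed
qed simp

section \<open>The Plancherel inequality\<close>

lemma lborel_affine_integral:
  fixes f :: "'a::euclidean_space \<Rightarrow> 'b::{banach, second_countable_topology}"
  assumes c: "c \<noteq> 0" and [measurable]: "f \<in> borel_measurable borel"
  shows "(LINT x|lborel. f x) = \<bar>c\<bar> ^ DIM('a) *\<^sub>R (LINT x|lborel. f (t + c *\<^sub>R x))"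
  by (subst lborel_affine[OF c, of t]) (simp add: integral_density integral_distr)

lemma lborel_affine_integrable:
  fixes f :: "'a::euclidean_space \<Rightarrow> 'b::{banach, second_countable_topology}"
  assumes c: "c \<noteq> 0" and f: "integrable lborel f"
  shows "integrable lborel (\<lambda>x. f (t + c *\<^sub>R x))"
proof -
  have [measurable]: "f \<in> borel_measurable borel" using f by (simp add: integrable_iff_bounded)
  have "integrable (density (distr lborel borel (\<lambda>x. t + c *\<^sub>R x)) (\<lambda>_. \<bar>c\<bar>^DIM('a))) f"
    using f lborel_affine[OF c, of t] by simp
  then have "integrable lborel (\<lambda>x. \<bar>c\<bar> ^ DIM('a) *\<^sub>R f (t + c *\<^sub>R x))"
    by (simp add: integrable_density integrable_distr_eq)
  from integrable_scaleR_right[OF this, of "1 / \<bar>c\<bar> ^ DIM('a)"] show ?thesis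
    using c by simp
qed

lemma integrable_tensor:
  fixes f :: "'a::euclidean_space \<Rightarrow> real" and g :: "'b::euclidean_space \<Rightarrow> real"
  assumes f: "integrable lborel f" and g: "integrable lborel g"
  shows "integrable (lborel \<Otimes>\<^sub>M lborel) (\<lambda>(x, y). f x * g y)"
proof (rule lborel_pair.Fubini_integrable)
  have [measurable]: "f \<in> borel_measurable borel" "g \<in> borel_measurable borel"
    using f g by (simp_all add: integrable_iff_bounded)
  show "(\<lambda>(x, y). f x * g y) \<in> borel_measurable (lborel \<Otimes>\<^sub>M lborel)"
    by measurable
  show "integrable lborel (\<lambda>x. LINT y|lborel. norm (case (x, y) of (x, y) \<Rightarrow> f x * g y))"
    using f g by (simp add: abs_mult)
qed (use g in simp)

text \<open>The frequency is written \<open>d *\<^sub>R z\<close> so that the substitution of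
  \<open>d *\<^sub>R x\<close> removes \<open>d\<close> from both factors at once and leaves only
  the Jacobian. Cosine and sine are kept apart because their multipliers will be 1 and
  \<open>i3\<close> in the Clifford algebra instead of 1 and the complex unit.\<close>

lemma gaussian_trig_scaled:
  fixes z :: "'a::euclidean_space"
  assumes d: "d > 0"
  defines "\<gamma> \<equiv> \<lambda>x::'a. exp (- (norm (d *\<^sub>R x))\<^sup>2 / 2)"
  shows "integrable lborel \<gamma>"
    and "(LINT x|lborel. \<gamma> x * cos (x \<bullet> (d *\<^sub>R z)))
      = (1 / d) ^ DIM('a) * (sqrt (2 * pi) ^ DIM('a) * exp (- (norm z)\<^sup>2 / 2))"
    and "(LINT x|lborel. \<gamma> x * sin (x \<bullet> (d *\<^sub>R z))) = 0"
proof -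
  let ?e = "\<lambda>x::'a. exp (- (norm x)\<^sup>2 / 2)"
  have [measurable]: "?e \<in> borel_measurable borel" by measurable
  have int0: "integrable lborel ?e"
    using integrable_Re[OF gaussian_fourier(1)[of "0::'a"]] by simp
  from lborel_affine_integrable[OF _ this, of d 0] d show "integrable lborel \<gamma>"
    by (simp add: \<gamma>_def)
  have "(LINT x|lborel. ?e x * cos (x \<bullet> z)) = Re (LINT x|lborel. of_real (?e x) * cis (x \<bullet> z))"
    by (subst integral_Re[symmetric, OF gaussian_fourier(1)]) simp
  also have "\<dots> = sqrt (2 * pi) ^ DIM('a) * exp (- (norm z)\<^sup>2 / 2)"
    by (subst gaussian_fourier(2)) (simp flip: of_real_mult of_real_power)
  finally have c: "(LINT x|lborel. ?e x * cos (x \<bullet> z)) = sqrt (2 * pi) ^ DIM('a) * exp (- (norm z)\<^sup>2 / 2)" .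
  have "(LINT x|lborel. ?e x * sin (x \<bullet> z)) = Im (LINT x|lborel. of_real (?e x) * cis (x \<bullet> z))"
    by (subst integral_Im[symmetric, OF gaussian_fourier(1)]) simp
  also have "\<dots> = 0"
    by (subst gaussian_fourier(2)) (simp flip: of_real_mult of_real_power)
  finally have s: "(LINT x|lborel. ?e x * sin (x \<bullet> z)) = 0" .
  have "(LINT x|lborel. ?e x * cos (x \<bullet> z)) = d ^ DIM('a) * (LINT x|lborel. \<gamma> x * cos (x \<bullet> (d *\<^sub>R z)))"
    using lborel_affine_integral[of d "\<lambda>x. ?e x * cos (x \<bullet> z)" 0] d by (simp add: \<gamma>_def)
  then show "(LINT x|lborel. \<gamma> x * cos (x \<bullet> (d *\<^sub>R z)))
      = (1 / d) ^ DIM('a) * (sqrt (2 * pi) ^ DIM('a) * exp (- (norm z)\<^sup>2 / 2))"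
    using d c by (simp add: field_simps)
  have "(LINT x|lborel. ?e x * sin (x \<bullet> z)) = d ^ DIM('a) * (LINT x|lborel. \<gamma> x * sin (x \<bullet> (d *\<^sub>R z)))"
    using lborel_affine_integral[of d "\<lambda>x. ?e x * sin (x \<bullet> z)" 0] d by (simp add: \<gamma>_def)
  then show "(LINT x|lborel. \<gamma> x * sin (x \<bullet> (d *\<^sub>R z))) = 0"
    using s d by simp
qed

section \<open>The phases as isometries of the algebra\<close>

lemma mult_exp_i3: "M * exp_i3 t = cos t *\<^sub>R M + sin t *\<^sub>R (M * i3)"
  by (simp add: exp_i3_def distrib_left)

lemma exp_i3_mult: "M * exp_i3 s * exp_i3 t = M * exp_i3 (s + t)"
proof -
  have "M * i3 * i3 = - M" by (simp add: mult.assoc i3_square)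
  then show ?thesis
    by (simp add: mult_exp_i3 distrib_right cos_add sin_add algebra_simps)
qed

text \<open>Right multiplication by \<open>i3\<close> is an isometry and skew-adjoint: an orthogonal
  complex structure on the eight-dimensional space.\<close>

lemma inner_mult_i3: "inner (M * i3) (N * i3) = inner M N" "inner (M * i3) N = - inner M (N * i3)"
  by (simp_all add: i3_eq inner_g3_def times_g3_def algebra_simps)

text \<open>A phase changes sign when it crosses the inner product, as complex conjugation would
  make it do.\<close>

lemma inner_mult_exp_i3: "inner (M * exp_i3 s) (N * exp_i3 t) = inner M (N * exp_i3 (t - s))"
  by (simp add: mult_exp_i3 inner_add_left inner_add_right inner_mult_i3 cos_diff sin_diff algebra_simps i3_square)

lemma exp_i3_0: "M * exp_i3 0 = M"
  by (simp add: mult_exp_i3)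

lemma norm_mult_exp_i3: "norm (M * exp_i3 t) = norm M"
  by (simp add: norm_eq_sqrt_inner inner_mult_exp_i3 exp_i3_0)

text \<open>Boundedness comes from finite dimension, since the norm is not
  submultiplicative.\<close>

lemma bounded_linear_mult_g3: "bounded_linear (\<lambda>M::g3. M * N)"
  unfolding linear_conv_bounded_linear[symmetric]
  by (rule linearI) (simp_all add: distrib_right)

lemma borel_measurable_mult_exp_i3 [measurable]:
  assumes [measurable]: "u \<in> borel_measurable M" "t \<in> borel_measurable M"
  shows "(\<lambda>x. u x * exp_i3 (t x)) \<in> borel_measurable M"
proof -
  have [measurable]: "(\<lambda>x. x * i3) \<in> borel_measurable borel"
    by (intro borel_measurable_continuous_onI linear_continuous_on bounded_linear_mult_g3)
  show ?thesis unfolding mult_exp_i3 by measurable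
qed

lemma integrable_mult_exp_i3:
  assumes "integrable M u" "t \<in> borel_measurable M"
  shows "integrable M (\<lambda>x. u x * exp_i3 (t x))"
  by (rule Bochner_Integration.integrable_bound[OF assms(1)])
     (use assms in \<open>auto simp: norm_mult_exp_i3\<close>)

text \<open>
  The Lebesgue measure is replaced by its restriction to the Borel sets because $(x, h) \mapsto u(x + h)$
  need not be measurable for the product of two completed measures.
\<close>

definition borel_cft :: "(real ^ 3 \<Rightarrow> g3) \<Rightarrow> real ^ 3 \<Rightarrow> g3" where
  "borel_cft u \<omega> = (LINT x|lborel. u x * exp_i3 (- (\<omega> \<bullet> x)))"

lemma borel_measurable_borel_cft [measurable]:
  assumes [measurable]: "u \<in> borel_measurable borel"
  shows "borel_cft u \<in> borel_measurable borel"
  unfolding borel_cft_def by measurable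

lemma integrable_norm_tensor:
  fixes u :: "'a::euclidean_space \<Rightarrow> g3"
  assumes "integrable lborel u"
  shows "integrable (lborel \<Otimes>\<^sub>M lborel) (\<lambda>(x, y). norm (u x) * norm (u y))"
  using assms by (intro integrable_tensor integrable_norm)

text \<open>The phases at \<open>x\<close> and \<open>y\<close> merge into one that depends only on
  \<open>x - y\<close>. In this form the frequency occurs once, so that it can be integrated out
  against a Gaussian. The double integral converges absolutely because \<open>u\<close> is
  integrable.\<close>

lemma norm_borel_cft_square:
  assumes u: "integrable lborel u"
  shows "(norm (borel_cft u \<omega>))\<^sup>2
    = (LINT p|(lborel \<Otimes>\<^sub>M lborel). inner (u (fst p)) (u (snd p) * exp_i3 (\<omega> \<bullet> (fst p - snd p))))"
proof -
  have [measurable]: "u \<in> borel_measurable borel" using u by (simp add: integrable_iff_bounded)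
  have int: "integrable lborel (\<lambda>x. u x * exp_i3 (- (\<omega> \<bullet> x)))"
    by (rule integrable_mult_exp_i3[OF u]) simp
  have "(norm (borel_cft u \<omega>))\<^sup>2 = inner (borel_cft u \<omega>) (borel_cft u \<omega>)"
    by (rule power2_norm_eq_inner)
  also have "\<dots> = (LINT x|lborel. inner (u x * exp_i3 (- (\<omega> \<bullet> x))) (borel_cft u \<omega>))"
    by (subst (1) borel_cft_def) (rule integral_inner_left[OF int, symmetric])
  also have "\<dots> = (LINT x|lborel. LINT y|lborel. inner (u x * exp_i3 (- (\<omega> \<bullet> x))) (u y * exp_i3 (- (\<omega> \<bullet> y))))"
    by (subst borel_cft_def, subst integral_inner_right[OF int]) simp
  also have "\<dots> = (LINT x|lborel. LINT y|lborel. inner (u x) (u y * exp_i3 (\<omega> \<bullet> (x - y))))"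
    by (simp add: inner_mult_exp_i3 inner_diff_right)
  also have "\<dots> = (LINT p|(lborel \<Otimes>\<^sub>M lborel). inner (u (fst p)) (u (snd p) * exp_i3 (\<omega> \<bullet> (fst p - snd p))))"
  proof -
    have "integrable (lborel \<Otimes>\<^sub>M lborel) (\<lambda>p. inner (u (fst p)) (u (snd p) * exp_i3 (\<omega> \<bullet> (fst p - snd p))))"
    proof (rule Bochner_Integration.integrable_bound[OF integrable_norm_tensor[OF u]], rule_tac [2] AE_I2)
      fix p
      show "norm (inner (u (fst p)) (u (snd p) * exp_i3 (\<omega> \<bullet> (fst p - snd p))))
          \<le> norm (case p of (x, y) \<Rightarrow> norm (u x) * norm (u y))"
        using Cauchy_Schwarz_ineq2[of "u (fst p)" "u (snd p) * exp_i3 (\<omega> \<bullet> (fst p - snd p))"]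
        by (simp add: case_prod_unfold norm_mult_exp_i3)
    qed measurable
    from lborel_pair.integral_fst'[OF this] show ?thesis by simp
  qed
  finally show ?thesis .
qed

text \<open>The sine integral vanishes, which removes the term with \<open>N * i3\<close> and leaves
  a real multiple of \<open>inner M N\<close>.\<close>

lemma gaussian_exp_i3:
  fixes z :: "real ^ 3"
  assumes d: "d > 0"
  shows "(LINT \<omega>|lborel. exp (- (norm (d *\<^sub>R \<omega>))\<^sup>2 / 2) * inner M (N * exp_i3 (\<omega> \<bullet> (d *\<^sub>R z))))
    = inner M N * ((1 / d) ^ 3 * (sqrt (2 * pi) ^ 3 * exp (- (norm z)\<^sup>2 / 2)))"
proof -
  let ?g = "\<lambda>\<omega>::real^3. exp (- (norm (d *\<^sub>R \<omega>))\<^sup>2 / 2)"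
  have c: "integrable lborel (\<lambda>\<omega>. ?g \<omega> * cos (\<omega> \<bullet> (d *\<^sub>R z)))"
    by (rule Bochner_Integration.integrable_bound[OF gaussian_trig_scaled(1)[OF d]]) (auto simp: abs_mult mult_left_le)
  have s: "integrable lborel (\<lambda>\<omega>. ?g \<omega> * sin (\<omega> \<bullet> (d *\<^sub>R z)))"
    by (rule Bochner_Integration.integrable_bound[OF gaussian_trig_scaled(1)[OF d]]) (auto simp: abs_mult mult_left_le)
  have "(LINT \<omega>|lborel. ?g \<omega> * inner M (N * exp_i3 (\<omega> \<bullet> (d *\<^sub>R z))))
    = (LINT \<omega>|lborel. inner M N * (?g \<omega> * cos (\<omega> \<bullet> (d *\<^sub>R z))) + inner M (N * i3) * (?g \<omega> * sin (\<omega> \<bullet> (d *\<^sub>R z))))"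
    by (intro Bochner_Integration.integral_cong refl) (simp add: mult_exp_i3 inner_add_right algebra_simps)
  also have "\<dots> = inner M N * (LINT \<omega>|lborel. ?g \<omega> * cos (\<omega> \<bullet> (d *\<^sub>R z)))
      + inner M (N * i3) * (LINT \<omega>|lborel. ?g \<omega> * sin (\<omega> \<bullet> (d *\<^sub>R z)))"
    using c s by (subst Bochner_Integration.integral_add) auto
  finally show ?thesis
    by (simp only: gaussian_trig_scaled[OF d]) simp
qed

text \<open>It holds without integrability because the Bochner integral then takes the default value
  0.\<close>

lemma ennreal_integral_le_nn_integral:
  assumes "\<And>x. f x \<ge> (0::real)"
  shows "ennreal (integral\<^sup>L M f) \<le> (\<integral>\<^sup>+x. ennreal (f x) \<partial>M)"
  by (cases "integrable M f") (simp_all add: assms nn_integral_eq_integral not_integrable_integral_eq)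

section \<open>Autocorrelation and the Gaussian average of the transform\<close>

lemma abs_inner_le_squares:
  "\<bar>inner a b\<bar> \<le> ((norm a)\<^sup>2 + (norm b)\<^sup>2) / 2"
proof -
  have "\<bar>inner a b\<bar> \<le> norm a * norm b" by (rule Cauchy_Schwarz_ineq2)
  moreover have "0 \<le> (norm a - norm b)\<^sup>2" by simp
  ultimately show ?thesis by (simp add: power2_diff)
qed

lemma square_integrable_Borel:
  fixes u :: "'a::euclidean_space \<Rightarrow> 'b::euclidean_space"
  assumes [measurable]: "u \<in> borel_measurable borel"
    and fin: "(\<integral>\<^sup>+x. ennreal ((norm (u x))\<^sup>2) \<partial>lborel) < \<infinity>"
  shows "integrable lborel (\<lambda>x. (norm (u x))\<^sup>2)"
  using fin by (intro integrableI_bounded) auto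

lemma nn_integral_translate_norm_square:
  fixes u :: "'a::euclidean_space \<Rightarrow> 'b::euclidean_space"
  assumes [measurable]: "u \<in> borel_measurable borel"
  shows "(\<integral>\<^sup>+x. ennreal ((norm (u (x + h)))\<^sup>2) \<partial>lborel) = (\<integral>\<^sup>+x. ennreal ((norm (u x))\<^sup>2) \<partial>lborel)"
  by (rule nn_integral_lborel_translate[where u = "\<lambda>x. ennreal ((norm (u x))\<^sup>2)"]) measurable

definition autocorr :: "('a::euclidean_space \<Rightarrow> 'b::euclidean_space) \<Rightarrow> 'a \<Rightarrow> real" where
  "autocorr u h = (LINT x|lborel. inner (u x) (u (x + h)))"

lemma nn_integral_autocorr_le:
  fixes u :: "'a::euclidean_space \<Rightarrow> 'b::euclidean_space"
  assumes [measurable]: "u \<in> borel_measurable borel"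
  shows "(\<integral>\<^sup>+x. ennreal \<bar>inner (u x) (u (x + h))\<bar> \<partial>lborel) \<le> (\<integral>\<^sup>+x. ennreal ((norm (u x))\<^sup>2) \<partial>lborel)"
proof -
  define c :: real where "c = 1 / 2"
  have c: "0 \<le> c" "c + c = 1" by (simp_all add: c_def)
  have "(\<integral>\<^sup>+x. ennreal \<bar>inner (u x) (u (x + h))\<bar> \<partial>lborel)
    \<le> (\<integral>\<^sup>+x. ennreal (c * (norm (u x))\<^sup>2 + c * (norm (u (x + h)))\<^sup>2) \<partial>lborel)"
    using abs_inner_le_squares
    by (intro nn_integral_mono ennreal_leI) (simp add: c_def add_divide_distrib)
  also have "\<dots> = ennreal c * (\<integral>\<^sup>+x. ennreal ((norm (u x))\<^sup>2) \<partial>lborel)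
      + ennreal c * (\<integral>\<^sup>+x. ennreal ((norm (u x))\<^sup>2) \<partial>lborel)"
    using c(1) by (simp add: ennreal_mult' nn_integral_add nn_integral_cmult nn_integral_translate_norm_square)
  also have "\<dots> = (\<integral>\<^sup>+x. ennreal ((norm (u x))\<^sup>2) \<partial>lborel)"
    using c by (simp flip: distrib_right ennreal_plus)
  finally show ?thesis .
qed

lemma abs_autocorr_le:
  fixes u :: "'a::euclidean_space \<Rightarrow> 'b::euclidean_space"
  assumes [measurable]: "u \<in> borel_measurable borel"
    and fin: "(\<integral>\<^sup>+x. ennreal ((norm (u x))\<^sup>2) \<partial>lborel) < \<infinity>"
  shows "\<bar>autocorr u h\<bar> \<le> (LINT x|lborel. (norm (u x))\<^sup>2)"
proof -
  note le = nn_integral_autocorr_le[OF assms(1), of h]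
  have "ennreal \<bar>autocorr u h\<bar> \<le> ennreal (LINT x|lborel. \<bar>inner (u x) (u (x + h))\<bar>)"
    unfolding autocorr_def by (intro ennreal_leI integral_abs_bound)
  also have "\<dots> \<le> (\<integral>\<^sup>+x. ennreal \<bar>inner (u x) (u (x + h))\<bar> \<partial>lborel)"
    by (rule ennreal_integral_le_nn_integral) simp
  also have "\<dots> \<le> ennreal (LINT x|lborel. (norm (u x))\<^sup>2)"
    using le nn_integral_eq_integral[OF square_integrable_Borel[OF assms]] by simp
  finally show ?thesis by simp
qed

text \<open>By polarisation and translation invariance the autocorrelation at \<open>h n\<close> is
  the energy minus half the squared norm of the translation difference, so continuity of
  translations in $L^2$ is all that remains.\<close>

lemma autocorr_tendsto:
  fixes u :: "'a::euclidean_space \<Rightarrow> 'b::euclidean_space"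
  assumes [measurable]: "u \<in> borel_measurable borel"
    and fin: "(\<integral>\<^sup>+x. ennreal ((norm (u x))\<^sup>2) \<partial>lborel) < \<infinity>"
    and h: "h \<longlonglongrightarrow> 0"
  shows "(\<lambda>n. autocorr u (h n)) \<longlonglongrightarrow> (LINT x|lborel. (norm (u x))\<^sup>2)"
proof -
  let ?E = "LINT x|lborel. (norm (u x))\<^sup>2"
  define D where "D n = (LINT x|lborel. (norm (u (x + h n) - u x))\<^sup>2)" for n
  have int: "integrable lborel (\<lambda>x. (norm (u x))\<^sup>2)"
    by (rule square_integrable_Borel[OF assms(1,2)])
  have int_h: "integrable lborel (\<lambda>x. (norm (u (x + k)))\<^sup>2)" for k
    using fin by (intro square_integrable_Borel) (simp_all add: nn_integral_translate_norm_square)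
  have E_h: "(LINT x|lborel. (norm (u (x + k)))\<^sup>2) = ?E" for k
    using nn_integral_eq_integral[OF int] nn_integral_eq_integral[OF int_h[of k]]
    by (simp add: nn_integral_translate_norm_square)
  have fin_D: "(\<integral>\<^sup>+x. ennreal ((norm (u (x + k) - u x))\<^sup>2) \<partial>lborel) < \<infinity>" for k
  proof -
    have "(\<integral>\<^sup>+x. ennreal ((norm (u (x + k) - u x))\<^sup>2) \<partial>lborel)
      \<le> 2 * (\<integral>\<^sup>+x. ennreal ((norm (u x))\<^sup>2) \<partial>lborel) + 2 * (\<integral>\<^sup>+x. ennreal ((norm (u x))\<^sup>2) \<partial>lborel)"
      using nn_integral_norm_add_square_le[of "\<lambda>x. u (x + k)" lborel "\<lambda>x. - u x" 1]
      by (simp add: nn_integral_translate_norm_square)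
    also have "\<dots> < \<infinity>"
      using fin by (simp add: ennreal_mult_less_top)
    finally show ?thesis .
  qed
  have int_D: "integrable lborel (\<lambda>x. (norm (u (x + k) - u x))\<^sup>2)" for k
    by (rule square_integrable_Borel[OF _ fin_D]) simp
  have eq: "autocorr u (h n) = ?E - D n / 2" for n
  proof -
    have "autocorr u (h n) = (LINT x|lborel. ((norm (u x))\<^sup>2 + (norm (u (x + h n)))\<^sup>2 - (norm (u (x + h n) - u x))\<^sup>2) / 2)"
      unfolding autocorr_def
      by (intro Bochner_Integration.integral_cong refl)
         (simp add: power2_norm_eq_inner inner_diff_left inner_diff_right inner_commute algebra_simps)
    also have "\<dots> = (?E + (LINT x|lborel. (norm (u (x + h n)))\<^sup>2) - D n) / 2"
      using int int_h int_D by (simp add: D_def)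
    finally show ?thesis by (simp add: E_h field_simps)
  qed
  have "(\<lambda>n. ennreal (D n)) \<longlonglongrightarrow> ennreal 0"
    using L2_translation_continuous[OF assms] nn_integral_eq_integral[OF int_D]
    by (simp add: D_def)
  then have "D \<longlonglongrightarrow> 0"
    by (subst (asm) tendsto_ennreal_iff) (auto simp: D_def)
  then have "(\<lambda>n. ?E - D n / 2) \<longlonglongrightarrow> ?E - 0 / 2" by (intro tendsto_intros) auto
  then show ?thesis by (simp add: eq)
qed

text \<open>Fubini is used twice, for different reasons. To integrate the frequency out first, the
  Gaussian weight and the integrability of \<open>u\<close> give absolute convergence. To integrate
  over \<open>x\<close> before \<open>z\<close>, the square integrability of \<open>u\<close> gives
  it, through the bound on the autocorrelation that is uniform in the shift.\<close>

lemma gaussian_weighted_borel_cft: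
  fixes u :: "real ^ 3 \<Rightarrow> g3"
  assumes u: "integrable lborel u"
    and fin: "(\<integral>\<^sup>+x. ennreal ((norm (u x))\<^sup>2) \<partial>lborel) < \<infinity>"
    and d: "d > 0"
  defines "G \<equiv> \<lambda>z::real^3. sqrt (2 * pi) ^ 3 * exp (- (norm z)\<^sup>2 / 2)"
  shows "(LINT \<omega>|lborel. exp (- (norm (d *\<^sub>R \<omega>))\<^sup>2 / 2) * (norm (borel_cft u \<omega>))\<^sup>2)
    = (LINT z|lborel. G z * autocorr u (d *\<^sub>R z))"
proof -
  have [measurable]: "u \<in> borel_measurable borel" using u by (simp add: integrable_iff_bounded)
  have [measurable]: "G \<in> borel_measurable borel" unfolding G_def by measurable
  let ?g = "\<lambda>\<omega>::real^3. exp (- (norm (d *\<^sub>R \<omega>))\<^sup>2 / 2)"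
  let ?H = "\<lambda>\<omega> p. ?g \<omega> * inner (u (fst p)) (u (snd p) * exp_i3 (\<omega> \<bullet> (fst p - snd p)))"
  let ?K = "\<lambda>p. inner (u (fst p)) (u (snd p)) * ((1 / d) ^ 3 * G ((1 / d) *\<^sub>R (fst p - snd p)))"
  have abs_le: "\<bar>inner (u (fst p)) (u (snd p) * exp_i3 t)\<bar> \<le> norm (u (fst p)) * norm (u (snd p))" for p t
    using Cauchy_Schwarz_ineq2[of "u (fst p)" "u (snd p) * exp_i3 t"] by (simp add: norm_mult_exp_i3)
  have int_uu: "integrable lborel (\<lambda>p::(real^3) \<times> (real^3). norm (u (fst p)) * norm (u (snd p)))"
    using integrable_norm_tensor[OF u] by (simp add: lborel_prod case_prod_unfold)
  have int_H: "integrable (lborel \<Otimes>\<^sub>M lborel) (\<lambda>(\<omega>, p). ?H \<omega> p)"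
  proof (rule Bochner_Integration.integrable_bound[OF integrable_tensor[OF gaussian_trig_scaled(1)[OF d] int_uu]])
    show "AE x in lborel \<Otimes>\<^sub>M lborel. norm (case x of (\<omega>, p) \<Rightarrow> ?H \<omega> p)
      \<le> norm (case x of (x, p) \<Rightarrow> ?g x * (norm (u (fst p)) * norm (u (snd p))))"
      using abs_le by (intro AE_I2) (auto simp: abs_mult)
  qed (simp add: lborel_prod[symmetric] case_prod_unfold, measurable)
  have int_K: "integrable (lborel \<Otimes>\<^sub>M lborel) ?K"
  proof (rule Bochner_Integration.integrable_bound)
    show "integrable (lborel \<Otimes>\<^sub>M lborel) (\<lambda>p. (1 / d) ^ 3 * sqrt (2 * pi) ^ 3 * (norm (u (fst p)) * norm (u (snd p))))"
      using int_uu by (intro integrable_mult_right) (simp add: lborel_prod)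
    have "\<bar>?K p\<bar> \<le> (1 / d) ^ 3 * sqrt (2 * pi) ^ 3 * (norm (u (fst p)) * norm (u (snd p)))" for p
    proof -
      have "\<bar>?K p\<bar> = \<bar>inner (u (fst p)) (u (snd p))\<bar> * ((1 / d) ^ 3 * G ((1 / d) *\<^sub>R (fst p - snd p)))"
        using d by (simp add: abs_mult G_def)
      also have "\<dots> \<le> (norm (u (fst p)) * norm (u (snd p))) * ((1 / d) ^ 3 * (sqrt (2 * pi) ^ 3 * 1))"
        using d abs_le[of p 0] unfolding G_def
        by (intro mult_mono mult_left_mono) (auto simp: exp_i3_0)
      finally show ?thesis by (simp add: mult_ac)
    qed
    then show "AE p in lborel \<Otimes>\<^sub>M lborel. norm (?K p)
      \<le> norm ((1 / d) ^ 3 * sqrt (2 * pi) ^ 3 * (norm (u (fst p)) * norm (u (snd p))))"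
      using d by (intro AE_I2) (simp add: abs_mult)
  qed measurable
  have "(LINT \<omega>|lborel. ?g \<omega> * (norm (borel_cft u \<omega>))\<^sup>2) = (LINT \<omega>|lborel. LINT p|lborel. ?H \<omega> p)"
    unfolding norm_borel_cft_square[OF u] lborel_prod by simp
  also have "\<dots> = (LINT p|lborel. LINT \<omega>|lborel. ?H \<omega> p)"
    by (rule lborel_pair.Fubini_integral[OF int_H, symmetric])
  also have "\<dots> = (LINT p|lborel. ?K p)"
    using gaussian_exp_i3[OF d, of _ _ "(1 / d) *\<^sub>R _"] d by (simp add: G_def)
  also have "\<dots> = (LINT x|lborel. LINT y|lborel. ?K (x, y))"
    using lborel_pair.integral_fst'[OF int_K] by (simp add: lborel_prod)
  also have "\<dots> = (LINT x|lborel. LINT z|lborel. G z * inner (u x) (u (x + d *\<^sub>R z)))"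
  proof (rule Bochner_Integration.integral_cong[OF refl])
    fix x
    \<comment> \<open>The substitution is \<open>y = x + d *\<^sub>R z\<close>. Its Jacobian cancels
      \<open>(1 / d) ^ 3\<close>, and the even function \<open>G\<close> does not see that
      \<open>x - y\<close> has become \<open>- d *\<^sub>R z\<close>.\<close>
    show "(LINT y|lborel. ?K (x, y)) = (LINT z|lborel. G z * inner (u x) (u (x + d *\<^sub>R z)))"
      using d by (subst lborel_affine_integral[of d _ x]) (simp_all add: G_def field_simps power3_eq_cube)
  qed
  also have "\<dots> = (LINT z|lborel. LINT x|lborel. G z * inner (u x) (u (x + d *\<^sub>R z)))"
  proof (rule lborel_pair.Fubini_integral)
    let ?C = "\<integral>\<^sup>+x. ennreal ((norm (u x))\<^sup>2) \<partial>lborel"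
    show "integrable (lborel \<Otimes>\<^sub>M lborel) (\<lambda>(z, x). G z * inner (u x) (u (x + d *\<^sub>R z)))"
    proof (rule integrableI_bounded)
      have "(\<integral>\<^sup>+p. ennreal (norm (case p of (z, x) \<Rightarrow> G z * inner (u x) (u (x + d *\<^sub>R z)))) \<partial>(lborel \<Otimes>\<^sub>M lborel))
        = (\<integral>\<^sup>+z. \<integral>\<^sup>+x. ennreal (norm (G z * inner (u x) (u (x + d *\<^sub>R z)))) \<partial>lborel \<partial>lborel)"
        by (subst lborel.nn_integral_fst[symmetric]) auto
      also have "\<dots> \<le> (\<integral>\<^sup>+z. ennreal (G z) * ?C \<partial>lborel)"
      proof (rule nn_integral_mono)
        fix z
        have "(\<integral>\<^sup>+x. ennreal (norm (G z * inner (u x) (u (x + d *\<^sub>R z)))) \<partial>lborel)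
          = ennreal (G z) * (\<integral>\<^sup>+x. ennreal \<bar>inner (u x) (u (x + d *\<^sub>R z))\<bar> \<partial>lborel)"
          by (subst nn_integral_cmult[symmetric]) (auto simp: G_def abs_mult ennreal_mult')
        also have "\<dots> \<le> ennreal (G z) * ?C"
          by (intro mult_left_mono nn_integral_autocorr_le) auto
        finally show "(\<integral>\<^sup>+x. ennreal (norm (G z * inner (u x) (u (x + d *\<^sub>R z)))) \<partial>lborel) \<le> ennreal (G z) * ?C" .
      qed
      also have "\<dots> = (\<integral>\<^sup>+z. ennreal (G z) \<partial>lborel) * ?C"
        by (rule nn_integral_multc) measurable
      also have "\<dots> < \<infinity>"
      proof -
        have "integrable lborel G"
          unfolding G_def using gaussian_trig_scaled(1)[of 1, where 'a="real^3"] by simp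
        moreover have "norm (G z) = G z" for z
          by (simp add: G_def)
        ultimately have "(\<integral>\<^sup>+z. ennreal (G z) \<partial>lborel) < \<infinity>"
          by (simp only: integrable_iff_bounded)
        then show ?thesis using fin by (simp add: ennreal_mult_less_top)
      qed
      finally show "(\<integral>\<^sup>+p. ennreal (norm (case p of (z, x) \<Rightarrow> G z * inner (u x) (u (x + d *\<^sub>R z)))) \<partial>(lborel \<Otimes>\<^sub>M lborel)) < \<infinity>" .
    qed measurable
  qed
  also have "\<dots> = (LINT z|lborel. G z * autocorr u (d *\<^sub>R z))"
    by (simp add: autocorr_def)
  finally show ?thesis .
qed

text \<open>The Gaussian weight is at most 1, so each average is below the full integral on the
  right, and so is the limit of the averages. On the other side \<open>G\<close> times the energy
  dominates, because the autocorrelation never exceeds the energy.\<close>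

lemma plancherel_le:
  fixes u :: "real ^ 3 \<Rightarrow> g3"
  assumes u: "integrable lborel u"
    and fin: "(\<integral>\<^sup>+x. ennreal ((norm (u x))\<^sup>2) \<partial>lborel) < \<infinity>"
  shows "ennreal ((2 * pi) ^ 3) * (\<integral>\<^sup>+x. ennreal ((norm (u x))\<^sup>2) \<partial>lborel)
    \<le> (\<integral>\<^sup>+\<omega>. ennreal ((norm (borel_cft u \<omega>))\<^sup>2) \<partial>lborel)"
proof -
  have [measurable]: "u \<in> borel_measurable borel" using u by (simp add: integrable_iff_bounded)
  let ?E = "LINT x|lborel. (norm (u x))\<^sup>2"
  define G where "G = (\<lambda>z::real^3. sqrt (2 * pi) ^ 3 * exp (- (norm z)\<^sup>2 / 2))"
  have [measurable]: "G \<in> borel_measurable borel" unfolding G_def by measurable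
  have int_G: "integrable lborel G"
    unfolding G_def using gaussian_trig_scaled(1)[of 1, where 'a="real^3"] by simp
  have [measurable]: "autocorr u \<in> borel_measurable borel"
    unfolding autocorr_def by measurable
  define d where "d n = 1 / real (Suc n)" for n
  have d_pos: "d n > 0" for n by (simp add: d_def)
  have d_lim: "d \<longlonglongrightarrow> 0" unfolding d_def by (rule LIMSEQ_Suc[OF lim_1_over_n])
  have "(\<lambda>n. LINT z|lborel. G z * autocorr u (d n *\<^sub>R z)) \<longlonglongrightarrow> (LINT z|lborel. G z * ?E)"
  proof (rule integral_dominated_convergence[where w = "\<lambda>z. G z * ?E"])
    show "AE z in lborel. (\<lambda>n. G z * autocorr u (d n *\<^sub>R z)) \<longlonglongrightarrow> G z * ?E"
    proof (intro AE_I2 tendsto_intros autocorr_tendsto fin)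
      fix z :: "real ^ 3"
      show "(\<lambda>n. d n *\<^sub>R z) \<longlonglongrightarrow> 0"
        using tendsto_scaleR[OF d_lim tendsto_const[of z]] by simp
    qed simp
    show "AE z in lborel. norm (G z * autocorr u (d n *\<^sub>R z)) \<le> G z * ?E" for n
      using abs_autocorr_le[OF _ fin] by (auto simp: abs_mult G_def intro!: mult_left_mono)
  qed (use int_G in auto)
  also have "(LINT z|lborel. G z * ?E) = (2 * pi) ^ 3 * ?E"
  proof -
    \<comment> \<open>One factor is built into \<open>G\<close> by the transform of the Gaussian
      weight, the other is the integral of the Gaussian; together they are the Plancherel
      constant.\<close>
    have "(LINT z|lborel. G z) = sqrt (2 * pi) ^ 3 * sqrt (2 * pi) ^ 3"
      unfolding G_def using gaussian_trig_scaled(2)[of 1 "0::real^3"] by simp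
    also have "\<dots> = (2 * pi) ^ 3"
      by (simp flip: power_mult_distrib)
    finally show ?thesis by simp
  qed
  finally have "(\<lambda>n. ennreal (LINT z|lborel. G z * autocorr u (d n *\<^sub>R z))) \<longlonglongrightarrow> ennreal ((2 * pi) ^ 3 * ?E)"
    by (rule tendsto_ennrealI)
  then have "ennreal ((2 * pi) ^ 3 * ?E) \<le> (\<integral>\<^sup>+\<omega>. ennreal ((norm (borel_cft u \<omega>))\<^sup>2) \<partial>lborel)"
  proof (rule LIMSEQ_le_const2, intro exI allI impI)
    fix n
    have "ennreal (LINT z|lborel. G z * autocorr u (d n *\<^sub>R z))
      = ennreal (LINT \<omega>|lborel. exp (- (norm (d n *\<^sub>R \<omega>))\<^sup>2 / 2) * (norm (borel_cft u \<omega>))\<^sup>2)"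
      unfolding G_def gaussian_weighted_borel_cft[OF u fin d_pos] ..
    also have "\<dots> \<le> (\<integral>\<^sup>+\<omega>. ennreal (exp (- (norm (d n *\<^sub>R \<omega>))\<^sup>2 / 2) * (norm (borel_cft u \<omega>))\<^sup>2) \<partial>lborel)"
      by (rule ennreal_integral_le_nn_integral) simp
    also have "\<dots> \<le> (\<integral>\<^sup>+\<omega>. ennreal ((norm (borel_cft u \<omega>))\<^sup>2) \<partial>lborel)"
      by (intro nn_integral_mono ennreal_leI mult_left_le_one_le) auto
    finally show "ennreal (LINT z|lborel. G z * autocorr u (d n *\<^sub>R z)) \<le> (\<integral>\<^sup>+\<omega>. ennreal ((norm (borel_cft u \<omega>))\<^sup>2) \<partial>lborel)" .
  qed
  moreover have "(\<integral>\<^sup>+x. ennreal ((norm (u x))\<^sup>2) \<partial>lborel) = ennreal ?E"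
    by (rule nn_integral_eq_integral[OF square_integrable_Borel[OF _ fin]]) auto
  ultimately show ?thesis by (simp add: ennreal_mult)
qed

section \<open>Passage to $L^2$ limits\<close>

text \<open>Lebesgue measurability is Borel measurability up to a null set for real functions; the
  coordinates are finitely many, so their null sets can be united.\<close>

lemma borel_version:
  fixes u :: "'a::euclidean_space \<Rightarrow> 'b::euclidean_space"
  assumes u: "u \<in> borel_measurable lebesgue"
  obtains v where "v \<in> borel_measurable borel" "AE x in lborel. u x = v x"
proof -
  have "\<exists>c. c \<in> borel_measurable borel \<and> (AE x in lborel. inner (u x) b = c x)" if "b \<in> Basis" for b
    using completion_ex_borel_measurable_real[of "\<lambda>x. inner (u x) b" lborel] u by auto
  then obtain c where c: "\<And>b. b \<in> Basis \<Longrightarrow> c b \<in> borel_measurable borel"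
    "\<And>b. b \<in> Basis \<Longrightarrow> AE x in lborel. inner (u x) b = c b x" by metis
  let ?v = "\<lambda>x. \<Sum>b\<in>Basis. c b x *\<^sub>R b"
  have "AE x in lborel. \<forall>b\<in>Basis. inner (u x) b = c b x"
    using c(2) by (intro AE_finite_allI) auto
  then have "AE x in lborel. u x = ?v x"
  proof eventually_elim
    case (elim x)
    have "u x = (\<Sum>b\<in>Basis. inner (u x) b *\<^sub>R b)" by (rule euclidean_representation[symmetric])
    with elim show ?case by simp
  qed
  moreover have "?v \<in> borel_measurable borel"
    using c(1) by (intro borel_measurable_sum borel_measurable_scaleR) auto
  ultimately show ?thesis using that by blast
qed

text \<open>Equality holds at every frequency, although the functions agree only almost everywhere,
  since each value of the transform is an integral.\<close>

lemma cft_eq_borel_cft: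
  assumes u: "u \<in> borel_measurable lebesgue" and v: "v \<in> borel_measurable borel"
    and eq: "AE x in lborel. u x = v x"
  shows "cft u = borel_cft v"
proof
  fix \<omega> :: "real ^ 3"
  have [measurable]: "(\<lambda>x. - (\<omega> \<bullet> x)) \<in> borel_measurable lebesgue"
    by (rule measurable_completion) simp
  have [measurable]: "v \<in> borel_measurable lebesgue"
    using v by (intro measurable_completion) simp
  note [measurable] = u
  have "cft u \<omega> = (LINT x|lebesgue. v x * exp_i3 (- (\<omega> \<bullet> x)))"
    unfolding cft_def
  proof (rule integral_cong_AE)
    show "AE x in lebesgue. u x * exp_i3 (- (\<omega> \<bullet> x)) = v x * exp_i3 (- (\<omega> \<bullet> x))"
      using AE_completion[OF eq] by eventually_elim simp
  qed measurable
  also have "\<dots> = borel_cft v \<omega>"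
    unfolding borel_cft_def using v by (intro integral_completion borel_measurable_mult_exp_i3) simp_all
  finally show "cft u \<omega> = borel_cft v \<omega>" .
qed

lemma integrable_borel_version:
  fixes u v :: "'a::euclidean_space \<Rightarrow> 'b::euclidean_space"
  assumes u: "integrable lebesgue u" and v: "v \<in> borel_measurable borel"
    and eq: "AE x in lborel. u x = v x"
  shows "integrable lborel v"
proof -
  have "v \<in> borel_measurable lebesgue"
    using v by (intro measurable_completion) simp
  then have "integrable lebesgue v"
    using u AE_completion[OF eq] by (subst integrable_cong_AE[of v _ u]) (auto elim: eventually_mono)
  then show ?thesis using v by (simp add: integrable_completion)
qed

text \<open>Serves both the Plancherel inequality and its version for translation differences. The
  order of limits matters: \<open>n\<close> goes to infinity with the slack fixed, and only then
  does the slack go to 0.\<close>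

lemma nn_integral_square_limit_le:
  fixes a :: "'a \<Rightarrow> 'c::{real_inner, second_countable_topology}"
    and b :: "'b \<Rightarrow> 'd::{real_inner, second_countable_topology}"
  assumes [measurable]: "\<And>n. an n \<in> borel_measurable M" "a \<in> borel_measurable M"
    "\<And>n. bn n \<in> borel_measurable N" "b \<in> borel_measurable N"
    and a_lim: "(\<lambda>n. \<integral>\<^sup>+x. ennreal ((norm (an n x - a x))\<^sup>2) \<partial>M) \<longlonglongrightarrow> 0"
    and b_lim: "(\<lambda>n. \<integral>\<^sup>+x. ennreal ((norm (bn n x - b x))\<^sup>2) \<partial>N) \<longlonglongrightarrow> 0"
    and le: "\<And>n::nat. ennreal C * (\<integral>\<^sup>+x. ennreal ((norm (an n x))\<^sup>2) \<partial>M) \<le> (\<integral>\<^sup>+x. ennreal ((norm (bn n x))\<^sup>2) \<partial>N)"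
  shows "ennreal C * (\<integral>\<^sup>+x. ennreal ((norm (a x))\<^sup>2) \<partial>M) \<le> (\<integral>\<^sup>+x. ennreal ((norm (b x))\<^sup>2) \<partial>N)"
    (is "_ * ?A \<le> ?B")
proof -
  let ?e = "\<lambda>n. \<integral>\<^sup>+x. ennreal ((norm (an n x - a x))\<^sup>2) \<partial>M"
  let ?e' = "\<lambda>n. \<integral>\<^sup>+x. ennreal ((norm (bn n x - b x))\<^sup>2) \<partial>N"
  \<comment> \<open>The slack \<open>t\<close> avoids the triangle inequality for $L^2$ norms.\<close>
  have scaled: "ennreal C * ?A \<le> ennreal (1 + t) * (ennreal (1 + t) * ?B)" if t: "t > 0" for t
  proof -
    let ?r = "\<lambda>n. ennreal (1 + t) * (ennreal (1 + t) * ?B + ennreal (1 + 1 / t) * ?e' n) + ennreal C * (ennreal (1 + 1 / t) * ?e n)"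
    have "?r \<longlonglongrightarrow> ennreal (1 + t) * (ennreal (1 + t) * ?B + ennreal (1 + 1 / t) * 0) + ennreal C * (ennreal (1 + 1 / t) * 0)"
      by (intro tendsto_add ennreal_tendsto_cmult a_lim b_lim tendsto_const) auto
    moreover have "ennreal C * ?A \<le> ?r n" for n
    proof -
      have "?A \<le> ennreal (1 + t) * (\<integral>\<^sup>+x. ennreal ((norm (an n x))\<^sup>2) \<partial>M) + ennreal (1 + 1 / t) * ?e n"
        using nn_integral_norm_add_square_le[of "an n" M "\<lambda>x. a x - an n x" t] t
        by (simp add: norm_minus_commute)
      then have "ennreal C * ?A \<le> ennreal C * (ennreal (1 + t) * (\<integral>\<^sup>+x. ennreal ((norm (an n x))\<^sup>2) \<partial>M) + ennreal (1 + 1 / t) * ?e n)"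
        by (rule mult_left_mono) simp
      also have "\<dots> = ennreal (1 + t) * (ennreal C * (\<integral>\<^sup>+x. ennreal ((norm (an n x))\<^sup>2) \<partial>M)) + ennreal C * (ennreal (1 + 1 / t) * ?e n)"
        by (simp add: distrib_left mult_ac)
      also have "\<dots> \<le> ?r n"
      proof (intro add_mono mult_left_mono order_refl)
        show "ennreal C * (\<integral>\<^sup>+x. ennreal ((norm (an n x))\<^sup>2) \<partial>M) \<le> ennreal (1 + t) * ?B + ennreal (1 + 1 / t) * ?e' n"
          using le[of n] nn_integral_norm_add_square_le[of b N "\<lambda>x. bn n x - b x" t] t
          by (simp add: order_trans)
      qed auto
      finally show ?thesis .
    qed
    ultimately have "ennreal C * ?A \<le> ennreal (1 + t) * (ennreal (1 + t) * ?B + ennreal (1 + 1 / t) * 0) + ennreal C * (ennreal (1 + 1 / t) * 0)"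
      by (intro LIMSEQ_le_const) auto
    then show ?thesis by simp
  qed
  show ?thesis
  proof (cases "?B = \<infinity>")
    case False
    then have "?B < top" by (simp add: less_top)
    \<comment> \<open>Now the slack is \<open>1 / Suc n\<close>. Finiteness of \<open>?B\<close> is
      what makes multiplication by it continuous.\<close>
    have "(\<lambda>n. ?B * (ennreal ((1 + 1 / real (Suc n)) * (1 + 1 / real (Suc n))))) \<longlonglongrightarrow> ?B * ennreal ((1 + 0) * (1 + 0))"
      by (intro ennreal_tendsto_cmult tendsto_ennrealI tendsto_intros LIMSEQ_Suc[OF lim_1_over_n] \<open>?B < top\<close>)
    moreover have "ennreal C * ?A \<le> ?B * (ennreal ((1 + 1 / real (Suc n)) * (1 + 1 / real (Suc n))))" for n
      using scaled[of "1 / real (Suc n)"] by (simp add: mult_ac ennreal_mult)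
    ultimately have "ennreal C * ?A \<le> ?B * ennreal ((1 + 0) * (1 + 0))"
      by (intro LIMSEQ_le_const) auto
    then show ?thesis by simp
  qed simp
qed

section \<open>Translation differences and their transforms\<close>

lemma borel_cft_translate_diff:
  assumes u: "integrable lborel u"
  shows "borel_cft (\<lambda>x. u (x + h) - u x) \<omega> = borel_cft u \<omega> * exp_i3 (\<omega> \<bullet> h) - borel_cft u \<omega>"
proof -
  have [measurable]: "u \<in> borel_measurable borel" using u by (simp add: integrable_iff_bounded)
  have int: "integrable lborel (\<lambda>x. u x * exp_i3 (- (\<omega> \<bullet> x)))"
    by (rule integrable_mult_exp_i3[OF u]) simp
  have int_h: "integrable lborel (\<lambda>x. u (x + h) * exp_i3 (- (\<omega> \<bullet> x)))"
    using lborel_affine_integrable[OF _ u, of 1 h]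
    by (intro integrable_mult_exp_i3) (simp_all add: add.commute)
  have "(LINT x|lborel. u (x + h) * exp_i3 (- (\<omega> \<bullet> x))) = (LINT x|lborel. u x * exp_i3 (- (\<omega> \<bullet> (x - h))))"
    by (subst lborel_affine_integral[of 1 "\<lambda>x. u x * exp_i3 (- (\<omega> \<bullet> (x - h)))" h])
       (simp_all add: add.commute)
  also have "\<dots> = (LINT x|lborel. u x * exp_i3 (- (\<omega> \<bullet> x)) * exp_i3 (\<omega> \<bullet> h))"
    by (simp add: exp_i3_mult inner_diff_right uminus_add_conv_diff)
  also have "\<dots> = borel_cft u \<omega> * exp_i3 (\<omega> \<bullet> h)"
    unfolding borel_cft_def by (rule integral_bounded_linear[OF bounded_linear_mult_g3 int])
  finally show ?thesis
    using int int_h by (simp add: borel_cft_def left_diff_distrib)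
qed

text \<open>\<open>M\<close> is orthogonal to \<open>M * i3\<close>, so the phase rotates
  \<open>M\<close> along a circle, and a chord of angle \<open>t\<close> has length 2 |sin (t/2)|
  times the radius.\<close>

lemma norm_mult_exp_i3_diff_le: "(norm (M * exp_i3 t - M))\<^sup>2 \<le> t\<^sup>2 * (norm M)\<^sup>2"
proof -
  have "(norm (M * exp_i3 t - M))\<^sup>2 = 2 * (norm M)\<^sup>2 - 2 * inner M (M * exp_i3 t)"
    using inner_mult_exp_i3[of M t M t]
    by (simp add: power2_norm_eq_inner inner_diff_left inner_diff_right
      inner_commute[of "M * exp_i3 t" M] exp_i3_0)
  also have "inner M (M * exp_i3 t) = cos t * (norm M)\<^sup>2"
    using inner_mult_i3(2)[of M M]
    by (simp add: mult_exp_i3 inner_add_right power2_norm_eq_inner inner_commute[of "M * i3"])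
  also have "2 * (norm M)\<^sup>2 - 2 * (cos t * (norm M)\<^sup>2) = (2 * sin (t / 2))\<^sup>2 * (norm M)\<^sup>2"
  proof -
    have "cos t = 1 - 2 * (sin (t / 2))\<^sup>2"
      using cos_double_sin[of "t / 2"] by simp
    then show ?thesis by (simp only:) (simp add: power_mult_distrib algebra_simps)
  qed
  also have "\<dots> \<le> t\<^sup>2 * (norm M)\<^sup>2"
  proof (rule mult_right_mono)
    have "\<bar>2 * sin (t / 2)\<bar> \<le> \<bar>t\<bar>"
      using abs_sin_x_le_abs_x[of "t / 2"] by (simp add: abs_mult)
    then show "(2 * sin (t / 2))\<^sup>2 \<le> t\<^sup>2"
      by (simp only: abs_le_square_iff)
  qed simp
  finally show ?thesis .
qed

lemma plancherel_translate_le: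
  assumes u: "integrable lborel u"
    and fin: "(\<integral>\<^sup>+x. ennreal ((norm (u x))\<^sup>2) \<partial>lborel) < \<infinity>"
  shows "ennreal ((2 * pi) ^ 3) * (\<integral>\<^sup>+x. ennreal ((norm (u (x + h) - u x))\<^sup>2) \<partial>lborel)
    \<le> (\<integral>\<^sup>+\<omega>. ennreal ((norm (borel_cft u \<omega> * exp_i3 (\<omega> \<bullet> h) - borel_cft u \<omega>))\<^sup>2) \<partial>lborel)"
proof -
  have [measurable]: "u \<in> borel_measurable borel" using u by (simp add: integrable_iff_bounded)
  have "(\<integral>\<^sup>+x. ennreal ((norm (u (x + h) - u x))\<^sup>2) \<partial>lborel)
    \<le> 2 * (\<integral>\<^sup>+x. ennreal ((norm (u x))\<^sup>2) \<partial>lborel) + 2 * (\<integral>\<^sup>+x. ennreal ((norm (u x))\<^sup>2) \<partial>lborel)"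
    using nn_integral_norm_add_square_le[of "\<lambda>x. u (x + h)" lborel "\<lambda>x. - u x" 1]
    by (simp add: nn_integral_translate_norm_square)
  also have "\<dots> < \<infinity>" using fin by (simp add: ennreal_mult_less_top)
  finally have "(\<integral>\<^sup>+x. ennreal ((norm (u (x + h) - u x))\<^sup>2) \<partial>lborel) < \<infinity>" .
  moreover have "integrable lborel (\<lambda>x. u (x + h) - u x)"
    using u lborel_affine_integrable[OF _ u, of 1 h] by (simp add: add.commute)
  ultimately show ?thesis
    using plancherel_le[of "\<lambda>x. u (x + h) - u x"] borel_cft_translate_diff[OF u, of h] by simp
qed

text \<open>Both alternatives of \<open>has_cft\<close> are reduced to Borel representatives with
  the two inequalities that the final argument uses. If \<open>f\<close> is integrable, finite
  energy allows the inequalities to be applied directly; otherwise they hold along the approximating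
  sequence and pass to the limit.\<close>

lemma has_cft_plancherel:
  assumes cft: "has_cft f g"
    and fin: "(\<integral>\<^sup>+x. ennreal ((norm (f x))\<^sup>2) \<partial>lebesgue) < \<infinity>"
  obtains f' g' where "f' \<in> borel_measurable borel" "g' \<in> borel_measurable borel"
    "AE x in lborel. f x = f' x" "AE x in lborel. g x = g' x"
    "ennreal ((2 * pi) ^ 3) * (\<integral>\<^sup>+x. ennreal ((norm (f' x))\<^sup>2) \<partial>lborel)
      \<le> (\<integral>\<^sup>+\<omega>. ennreal ((norm (g' \<omega>))\<^sup>2) \<partial>lborel)"
    "\<And>h. ennreal ((2 * pi) ^ 3) * (\<integral>\<^sup>+x. ennreal ((norm (f' (x + h) - f' x))\<^sup>2) \<partial>lborel)
      \<le> (\<integral>\<^sup>+\<omega>. ennreal ((norm (g' \<omega> * exp_i3 (\<omega> \<bullet> h) - g' \<omega>))\<^sup>2) \<partial>lborel)"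
  using cft unfolding has_cft_def
proof (elim disjE conjE)
  assume int: "integrable lebesgue f" and g: "g = cft f"
  have f_meas: "f \<in> borel_measurable lebesgue" using int by (rule borel_measurable_integrable)
  obtain f' where f': "f' \<in> borel_measurable borel" "AE x in lborel. f x = f' x"
    using borel_version[OF f_meas] .
  have int': "integrable lborel f'" by (rule integrable_borel_version[OF int f'])
  have "(\<integral>\<^sup>+x. ennreal ((norm (f' x))\<^sup>2) \<partial>lborel) = (\<integral>\<^sup>+x. ennreal ((norm (f x))\<^sup>2) \<partial>lborel)"
    using f'(2) by (intro nn_integral_cong_AE) (auto elim: eventually_mono)
  then have fin': "(\<integral>\<^sup>+x. ennreal ((norm (f' x))\<^sup>2) \<partial>lborel) < \<infinity>"
    using fin by (simp add: nn_integral_completion)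
  show ?thesis
  proof (rule that[of f' "borel_cft f'"])
    show "AE x in lborel. g x = borel_cft f' x"
      by (simp add: g cft_eq_borel_cft[OF f_meas f'])
  qed (use f' plancherel_le[OF int' fin'] plancherel_translate_le[OF int' fin'] in auto)
next
  assume "has_plancherel_cft f g"
  then obtain \<phi> where meas: "f \<in> borel_measurable lebesgue" "g \<in> borel_measurable lebesgue"
    and int: "\<And>n. integrable lebesgue (\<phi> n)" and sq: "\<And>n. square_integrable (\<phi> n)"
    and \<phi>_lim: "L2_tendsto \<phi> f" and cft_lim: "L2_tendsto (\<lambda>n. cft (\<phi> n)) g"
    unfolding has_plancherel_cft_def square_integrable_def by blast
  obtain f' where f': "f' \<in> borel_measurable borel" "AE x in lborel. f x = f' x"
    using borel_version[OF meas(1)] .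
  obtain g' where g': "g' \<in> borel_measurable borel" "AE x in lborel. g x = g' x"
    using borel_version[OF meas(2)] .
  have "\<exists>v. v \<in> borel_measurable borel \<and> (AE x in lborel. \<phi> n x = v x)" for n
    using borel_version[OF borel_measurable_integrable[OF int]] by metis
  then obtain v where v: "\<And>n. v n \<in> borel_measurable borel" "\<And>n. AE x in lborel. \<phi> n x = v n x"
    by metis
  have int_v: "integrable lborel (v n)" for n
    by (rule integrable_borel_version[OF int v])
  have "(\<integral>\<^sup>+x. ennreal ((norm (v n x))\<^sup>2) \<partial>lborel) = (\<integral>\<^sup>+x. ennreal ((norm (\<phi> n x))\<^sup>2) \<partial>lborel)" for n
    using v(2)[of n] by (intro nn_integral_cong_AE) (auto elim: eventually_mono)
  then have fin_v: "(\<integral>\<^sup>+x. ennreal ((norm (v n x))\<^sup>2) \<partial>lborel) < \<infinity>" for n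
    using sq[of n] by (simp add: square_integrable_def nn_integral_completion)
  note [measurable] = f'(1) g'(1) v(1)
  have "(\<integral>\<^sup>+x. ennreal ((norm (\<phi> n x - f x))\<^sup>2) \<partial>lborel) = (\<integral>\<^sup>+x. ennreal ((norm (v n x - f' x))\<^sup>2) \<partial>lborel)" for n
    using v(2)[of n] f'(2) by (intro nn_integral_cong_AE) (auto elim: eventually_elim2)
  then have v_lim: "(\<lambda>n. \<integral>\<^sup>+x. ennreal ((norm (v n x - f' x))\<^sup>2) \<partial>lborel) \<longlonglongrightarrow> 0"
    using \<phi>_lim by (simp add: L2_tendsto_def nn_integral_completion)
  have "(\<integral>\<^sup>+x. ennreal ((norm (cft (\<phi> n) x - g x))\<^sup>2) \<partial>lborel) = (\<integral>\<^sup>+x. ennreal ((norm (borel_cft (v n) x - g' x))\<^sup>2) \<partial>lborel)" for n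
    unfolding cft_eq_borel_cft[OF borel_measurable_integrable[OF int] v]
    using g'(2) by (intro nn_integral_cong_AE) (auto elim: eventually_mono)
  then have borel_cft_lim: "(\<lambda>n. \<integral>\<^sup>+x. ennreal ((norm (borel_cft (v n) x - g' x))\<^sup>2) \<partial>lborel) \<longlonglongrightarrow> 0"
    using cft_lim by (simp add: L2_tendsto_def nn_integral_completion)
  show ?thesis
  proof (rule that[OF f'(1) g'(1) f'(2) g'(2)])
    show "ennreal ((2 * pi) ^ 3) * (\<integral>\<^sup>+x. ennreal ((norm (f' x))\<^sup>2) \<partial>lborel)
      \<le> (\<integral>\<^sup>+\<omega>. ennreal ((norm (g' \<omega>))\<^sup>2) \<partial>lborel)"
      by (rule nn_integral_square_limit_le[OF _ _ _ _ v_lim borel_cft_lim plancherel_le[OF int_v fin_v]]) simp_all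
    fix h
    \<comment> \<open>Source of the 4: on either side the map applied is an isometry minus the
      identity (a translation, or multiplication by a phase), so it at most doubles
      distances.\<close>
    have four: "(\<lambda>n. ennreal 4 * w n) \<longlonglongrightarrow> 0" if "w \<longlonglongrightarrow> 0" for w :: "nat \<Rightarrow> ennreal"
      using ennreal_tendsto_cmult[OF _ that, of "ennreal 4"] by simp
    have "(\<lambda>n. \<integral>\<^sup>+x. ennreal ((norm ((v n (x + h) - v n x) - (f' (x + h) - f' x)))\<^sup>2) \<partial>lborel) \<longlonglongrightarrow> 0"
    proof (rule tendsto_sandwich[OF _ _ tendsto_const four[OF v_lim]])
      show "\<forall>\<^sub>F n in sequentially. (\<integral>\<^sup>+x. ennreal ((norm ((v n (x + h) - v n x) - (f' (x + h) - f' x)))\<^sup>2) \<partial>lborel)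
        \<le> ennreal 4 * (\<integral>\<^sup>+x. ennreal ((norm (v n x - f' x))\<^sup>2) \<partial>lborel)"
      proof (intro always_eventually allI)
        fix n
        let ?w = "\<lambda>x. v n x - f' x"
        have "(\<integral>\<^sup>+x. ennreal ((norm ((v n (x + h) - v n x) - (f' (x + h) - f' x)))\<^sup>2) \<partial>lborel)
          \<le> 2 * (\<integral>\<^sup>+x. ennreal ((norm (?w (x + h)))\<^sup>2) \<partial>lborel) + 2 * (\<integral>\<^sup>+x. ennreal ((norm (?w x))\<^sup>2) \<partial>lborel)"
          using nn_integral_norm_add_square_le[of "\<lambda>x. ?w (x + h)" lborel "\<lambda>x. - ?w x" 1]
          by (simp add: algebra_simps norm_minus_commute)
        also have "\<dots> = ennreal 4 * (\<integral>\<^sup>+x. ennreal ((norm (?w x))\<^sup>2) \<partial>lborel)"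
          by (subst nn_integral_translate_norm_square) (simp_all flip: distrib_right)
        finally show "(\<integral>\<^sup>+x. ennreal ((norm ((v n (x + h) - v n x) - (f' (x + h) - f' x)))\<^sup>2) \<partial>lborel)
          \<le> ennreal 4 * (\<integral>\<^sup>+x. ennreal ((norm (v n x - f' x))\<^sup>2) \<partial>lborel)" .
      qed
    qed simp
    moreover have "(\<lambda>n. \<integral>\<^sup>+\<omega>. ennreal ((norm ((borel_cft (v n) \<omega> * exp_i3 (\<omega> \<bullet> h) - borel_cft (v n) \<omega>)
        - (g' \<omega> * exp_i3 (\<omega> \<bullet> h) - g' \<omega>)))\<^sup>2) \<partial>lborel) \<longlonglongrightarrow> 0"
    proof (rule tendsto_sandwich[OF _ _ tendsto_const four[OF borel_cft_lim]])
      show "\<forall>\<^sub>F n in sequentially. (\<integral>\<^sup>+\<omega>. ennreal ((norm ((borel_cft (v n) \<omega> * exp_i3 (\<omega> \<bullet> h) - borel_cft (v n) \<omega>)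
          - (g' \<omega> * exp_i3 (\<omega> \<bullet> h) - g' \<omega>)))\<^sup>2) \<partial>lborel)
        \<le> ennreal 4 * (\<integral>\<^sup>+\<omega>. ennreal ((norm (borel_cft (v n) \<omega> - g' \<omega>))\<^sup>2) \<partial>lborel)"
      proof (intro always_eventually allI)
        fix n
        have "(norm ((borel_cft (v n) \<omega> * exp_i3 (\<omega> \<bullet> h) - borel_cft (v n) \<omega>) - (g' \<omega> * exp_i3 (\<omega> \<bullet> h) - g' \<omega>)))\<^sup>2
          \<le> 4 * (norm (borel_cft (v n) \<omega> - g' \<omega>))\<^sup>2" for \<omega>
        proof -
          have "(borel_cft (v n) \<omega> * exp_i3 (\<omega> \<bullet> h) - borel_cft (v n) \<omega>) - (g' \<omega> * exp_i3 (\<omega> \<bullet> h) - g' \<omega>)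
            = (borel_cft (v n) \<omega> - g' \<omega>) * exp_i3 (\<omega> \<bullet> h) - (borel_cft (v n) \<omega> - g' \<omega>)"
            by (simp add: left_diff_distrib)
          then show ?thesis
            by (metis norm_diff_square_le_4 norm_mult_exp_i3 order_refl)
        qed
        then have "(\<integral>\<^sup>+\<omega>. ennreal ((norm ((borel_cft (v n) \<omega> * exp_i3 (\<omega> \<bullet> h) - borel_cft (v n) \<omega>)
            - (g' \<omega> * exp_i3 (\<omega> \<bullet> h) - g' \<omega>)))\<^sup>2) \<partial>lborel)
          \<le> (\<integral>\<^sup>+\<omega>. ennreal (4 * (norm (borel_cft (v n) \<omega> - g' \<omega>))\<^sup>2) \<partial>lborel)"
          by (intro nn_integral_mono ennreal_leI)
        also have "\<dots> = ennreal 4 * (\<integral>\<^sup>+\<omega>. ennreal ((norm (borel_cft (v n) \<omega> - g' \<omega>))\<^sup>2) \<partial>lborel)"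
          by (subst nn_integral_cmult[symmetric]) (auto simp: ennreal_mult')
        finally show "(\<integral>\<^sup>+\<omega>. ennreal ((norm ((borel_cft (v n) \<omega> * exp_i3 (\<omega> \<bullet> h) - borel_cft (v n) \<omega>)
            - (g' \<omega> * exp_i3 (\<omega> \<bullet> h) - g' \<omega>)))\<^sup>2) \<partial>lborel)
          \<le> ennreal 4 * (\<integral>\<^sup>+\<omega>. ennreal ((norm (borel_cft (v n) \<omega> - g' \<omega>))\<^sup>2) \<partial>lborel)" .
      qed
    qed simp
    ultimately show "ennreal ((2 * pi) ^ 3) * (\<integral>\<^sup>+x. ennreal ((norm (f' (x + h) - f' x))\<^sup>2) \<partial>lborel)
      \<le> (\<integral>\<^sup>+\<omega>. ennreal ((norm (g' \<omega> * exp_i3 (\<omega> \<bullet> h) - g' \<omega>))\<^sup>2) \<partial>lborel)"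
      by (rule nn_integral_square_limit_le[OF _ _ _ _ _ _ plancherel_translate_le[OF int_v fin_v], rotated 4]) simp_all
  qed
qed

section \<open>The uncertainty inequality\<close>

text \<open>A discriminant argument: the best choice is \<open>t = E / B\<close>. If
  \<open>B\<close> were 0, the right side would be constant in \<open>t\<close>, which a large
  \<open>t\<close> contradicts unless \<open>E\<close> is 0.\<close>

lemma quadratic_bound:
  fixes A B E :: real
  assumes "A \<ge> 0" "B \<ge> 0" "E \<ge> 0" and le: "\<And>t. t > 0 \<Longrightarrow> 2 * t * E \<le> t\<^sup>2 * B + 4 * A"
  shows "E\<^sup>2 \<le> 4 * A * B"
proof (cases "E = 0")
  case True
  then show ?thesis using assms by simp
next
  case False
  then have E: "E > 0" using assms by simp
  have B: "B > 0"
  proof (rule ccontr)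
    assume "\<not> B > 0"
    then have "B = 0" using assms by simp
    then have "2 * (2 * (\<bar>A\<bar> + 1) / E) * E \<le> 4 * A"
      using le[of "2 * (\<bar>A\<bar> + 1) / E"] E by simp
    then show False using E by simp
  qed
  then show ?thesis
    using le[of "E / B"] E by (simp add: field_simps power2_eq_square)
qed

text \<open>\<open>B\<close> bounds the squared norm of every difference quotient in direction
  \<open>b\<close> and stands for the squared norm of a derivative. The factor 4 arises because the
  difference of the two squared norms contains the sum of \<open>f\<close> and its translate, which
  is close to 2 \<open>f\<close> for small \<open>s\<close>.\<close>

lemma directional_uncertainty:
  fixes f :: "'a::euclidean_space \<Rightarrow> 'b::euclidean_space"
  assumes [measurable]: "f \<in> borel_measurable borel"
    and b: "norm b = 1"
    and int_f: "integrable lborel (\<lambda>x. (norm (f x))\<^sup>2)"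
    and int_xf: "integrable lborel (\<lambda>x. (x \<bullet> b)\<^sup>2 * (norm (f x))\<^sup>2)"
    and B: "B \<ge> 0"
    and transl: "\<And>s. (\<integral>\<^sup>+x. ennreal ((norm (f (x + s *\<^sub>R b) - f x))\<^sup>2) \<partial>lborel) \<le> ennreal (s\<^sup>2 * B)"
  shows "(LINT x|lborel. (norm (f x))\<^sup>2)\<^sup>2 \<le> 4 * (LINT x|lborel. (x \<bullet> b)\<^sup>2 * (norm (f x))\<^sup>2) * B"
proof -
  let ?E = "LINT x|lborel. (norm (f x))\<^sup>2"
  let ?A = "LINT x|lborel. (x \<bullet> b)\<^sup>2 * (norm (f x))\<^sup>2"
  let ?m = "LINT x|lborel. (x \<bullet> b) * (norm (f x))\<^sup>2"
  have bb: "b \<bullet> b = 1" using b by (simp add: norm_eq_1)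
  have int_m: "integrable lborel (\<lambda>x. (x \<bullet> b) * (norm (f x))\<^sup>2)"
  proof (rule Bochner_Integration.integrable_bound)
    show "integrable lborel (\<lambda>x. (norm (f x))\<^sup>2 + (x \<bullet> b)\<^sup>2 * (norm (f x))\<^sup>2)"
      by (intro Bochner_Integration.integrable_add int_f int_xf)
    have "\<bar>y\<bar> \<le> 1 + y\<^sup>2" for y :: real
      using zero_le_power2[of "\<bar>y\<bar> - 1"] by (simp add: power2_diff)
    then have "\<bar>x \<bullet> b\<bar> * (norm (f x))\<^sup>2 \<le> (1 + (x \<bullet> b)\<^sup>2) * (norm (f x))\<^sup>2" for x
      by (intro mult_right_mono) auto
    then show "AE x in lborel. norm ((x \<bullet> b) * (norm (f x))\<^sup>2) \<le> norm ((norm (f x))\<^sup>2 + (x \<bullet> b)\<^sup>2 * (norm (f x))\<^sup>2)"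
      by (auto simp: abs_mult distrib_right)
  qed measurable
  \<comment> \<open>Below, \<open>p\<close> is \<open>y - s\<close> or its square; the shift by
    \<open>s *\<^sub>R b\<close> turns these into plain moments of the translate because
    \<open>b\<close> is a unit vector. Expanding them is what brings in the first moment
    \<open>?m\<close>.\<close>
  have transl_eq: "integrable lborel (\<lambda>x. p ((x + s *\<^sub>R b) \<bullet> b) * (norm (f (x + s *\<^sub>R b)))\<^sup>2)"
      "(LINT x|lborel. p ((x + s *\<^sub>R b) \<bullet> b) * (norm (f (x + s *\<^sub>R b)))\<^sup>2) = (LINT x|lborel. p (x \<bullet> b) * (norm (f x))\<^sup>2)"
    if "integrable lborel (\<lambda>x. p (x \<bullet> b) * (norm (f x))\<^sup>2)" for p :: "real \<Rightarrow> real" and s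
    using lborel_affine_integrable[OF _ that, of 1 "s *\<^sub>R b"] borel_measurable_integrable[OF that]
      lborel_affine_integral[of 1 "\<lambda>x. p (x \<bullet> b) * (norm (f x))\<^sup>2" "s *\<^sub>R b"]
    by (simp_all add: add.commute)
  \<comment> \<open>AM-GM with weights \<open>t\<close> and \<open>s\<close> stands in for the Cauchy--Schwarz inequality.\<close>
  have core: "2 * t * ?E \<le> t\<^sup>2 * B + (4 * ?A - 4 * s * ?m + 2 * s\<^sup>2 * ?E)" if t: "t > 0" and s: "s > 0" for t s
  proof -
    let ?c = "\<lambda>x. f (x + s *\<^sub>R b)"
    have int1: "integrable lborel (\<lambda>x. (x \<bullet> b) * (norm (?c x))\<^sup>2)"
      and eq1: "(LINT x|lborel. (x \<bullet> b) * (norm (?c x))\<^sup>2) = ?m - s * ?E"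
    proof -
      have i: "integrable lborel (\<lambda>x. (x \<bullet> b - s) * (norm (f x))\<^sup>2)"
        using int_m int_f by (simp add: left_diff_distrib)
      from transl_eq[OF i, of s] show "integrable lborel (\<lambda>x. (x \<bullet> b) * (norm (?c x))\<^sup>2)"
        by (simp add: inner_add_left bb)
      from transl_eq[OF i, of s] show "(LINT x|lborel. (x \<bullet> b) * (norm (?c x))\<^sup>2) = ?m - s * ?E"
        using int_m int_f by (simp add: inner_add_left bb left_diff_distrib)
    qed
    have int2: "integrable lborel (\<lambda>x. (x \<bullet> b)\<^sup>2 * (norm (?c x))\<^sup>2)"
      and eq2: "(LINT x|lborel. (x \<bullet> b)\<^sup>2 * (norm (?c x))\<^sup>2) = ?A - 2 * s * ?m + s\<^sup>2 * ?E"
    proof -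
      have e: "(x \<bullet> b - s)\<^sup>2 * (norm (f x))\<^sup>2
        = (x \<bullet> b)\<^sup>2 * (norm (f x))\<^sup>2 - (2 * s) * ((x \<bullet> b) * (norm (f x))\<^sup>2) + s\<^sup>2 * (norm (f x))\<^sup>2" for x
        by (simp add: power2_diff algebra_simps)
      have i: "integrable lborel (\<lambda>x. (x \<bullet> b - s)\<^sup>2 * (norm (f x))\<^sup>2)"
        unfolding e by (intro Bochner_Integration.integrable_add Bochner_Integration.integrable_diff
          integrable_mult_right int_m int_f int_xf)
      from transl_eq[where p = "\<lambda>y. (y - s)\<^sup>2", OF i, of s]
      show "integrable lborel (\<lambda>x. (x \<bullet> b)\<^sup>2 * (norm (?c x))\<^sup>2)"
        by (simp add: inner_add_left bb)
      from transl_eq[where p = "\<lambda>y. (y - s)\<^sup>2", OF i, of s]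
      have "(LINT x|lborel. (x \<bullet> b)\<^sup>2 * (norm (?c x))\<^sup>2) = (LINT x|lborel. (x \<bullet> b - s)\<^sup>2 * (norm (f x))\<^sup>2)"
        by (simp add: inner_add_left bb)
      also have "\<dots> = ?A - 2 * s * ?m + s\<^sup>2 * ?E"
        unfolding e using int_m int_f int_xf by simp
      finally show "(LINT x|lborel. (x \<bullet> b)\<^sup>2 * (norm (?c x))\<^sup>2) = ?A - 2 * s * ?m + s\<^sup>2 * ?E" .
    qed
    have int_D: "integrable lborel (\<lambda>x. (norm (?c x - f x))\<^sup>2)"
      using transl[of s] by (intro square_integrable_Borel) (auto intro: le_less_trans)
    have D_le: "(LINT x|lborel. (norm (?c x - f x))\<^sup>2) \<le> s\<^sup>2 * B"
      using transl[of s] B unfolding nn_integral_eq_integral[OF int_D, simplified] by simp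
    have pt: "2 * t * s * ((x \<bullet> b) * (norm (f x))\<^sup>2 - (x \<bullet> b) * (norm (?c x))\<^sup>2)
      \<le> t\<^sup>2 * (norm (?c x - f x))\<^sup>2 + s\<^sup>2 * (2 * ((x \<bullet> b)\<^sup>2 * (norm (f x))\<^sup>2) + 2 * ((x \<bullet> b)\<^sup>2 * (norm (?c x))\<^sup>2))" for x
    proof -
      \<comment> \<open>The difference of the squared norms factors as an inner product of
        difference and sum. The weight \<open>x \<bullet> b\<close> goes entirely to the sum, so
        that \<open>transl\<close> controls \<open>P\<close> and the second moment controls
        \<open>Q\<close>.\<close>
      define P where "P = f x - ?c x"
      define Q where "Q = (x \<bullet> b) *\<^sub>R (f x + ?c x)"
      have "(x \<bullet> b) * (norm (f x))\<^sup>2 - (x \<bullet> b) * (norm (?c x))\<^sup>2 = P \<bullet> Q"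
        unfolding P_def Q_def power2_norm_eq_inner
        by (simp add: inner_diff_left inner_add_right inner_commute algebra_simps)
      moreover have "2 * (t * s) * (P \<bullet> Q) \<le> t\<^sup>2 * (norm P)\<^sup>2 + s\<^sup>2 * (norm Q)\<^sup>2"
        using abs_inner_le_squares[of "t *\<^sub>R P" "s *\<^sub>R Q"] by (simp add: power_mult_distrib mult_ac)
      moreover have "(norm Q)\<^sup>2 \<le> 2 * ((x \<bullet> b)\<^sup>2 * (norm (f x))\<^sup>2) + 2 * ((x \<bullet> b)\<^sup>2 * (norm (?c x))\<^sup>2)"
        using norm_add_square_le[of 1 "(x \<bullet> b) *\<^sub>R f x" "(x \<bullet> b) *\<^sub>R ?c x"]
        by (simp add: Q_def scaleR_add_right power_mult_distrib)
      then have "s\<^sup>2 * (norm Q)\<^sup>2 \<le> s\<^sup>2 * (2 * ((x \<bullet> b)\<^sup>2 * (norm (f x))\<^sup>2) + 2 * ((x \<bullet> b)\<^sup>2 * (norm (?c x))\<^sup>2))"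
        by (rule mult_left_mono) simp
      ultimately show ?thesis
        by (simp add: P_def norm_minus_commute mult.assoc)
    qed
    have "2 * t * s * (?m - (?m - s * ?E)) = (LINT x|lborel. 2 * t * s * ((x \<bullet> b) * (norm (f x))\<^sup>2 - (x \<bullet> b) * (norm (?c x))\<^sup>2))"
      using int_m int1 by (simp add: eq1)
    also have "\<dots> \<le> (LINT x|lborel. t\<^sup>2 * (norm (?c x - f x))\<^sup>2 + s\<^sup>2 * (2 * ((x \<bullet> b)\<^sup>2 * (norm (f x))\<^sup>2) + 2 * ((x \<bullet> b)\<^sup>2 * (norm (?c x))\<^sup>2)))"
      using int_m int1 int_D int_xf int2 by (intro integral_mono pt) auto
    also have "\<dots> = t\<^sup>2 * (LINT x|lborel. (norm (?c x - f x))\<^sup>2) + s\<^sup>2 * (2 * ?A + 2 * (?A - 2 * s * ?m + s\<^sup>2 * ?E))"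
      using int_D int_xf int2 by (simp add: eq2)
    also have "\<dots> \<le> t\<^sup>2 * (s\<^sup>2 * B) + s\<^sup>2 * (2 * ?A + 2 * (?A - 2 * s * ?m + s\<^sup>2 * ?E))"
      using D_le by (intro add_mono mult_left_mono) auto
    \<comment> \<open>Every term carries \<open>s\<^sup>2\<close>: on the left one \<open>s\<close>
      is the weight and the other comes from the shifted first moment, on the right they come from
      \<open>transl\<close> and from the weight on \<open>Q\<close>.\<close>
    finally have "s\<^sup>2 * (2 * t * ?E) \<le> s\<^sup>2 * (t\<^sup>2 * B + (4 * ?A - 4 * s * ?m + 2 * s\<^sup>2 * ?E))"
      by (simp add: algebra_simps power2_eq_square)
    then show ?thesis
      using s by (simp add: mult_le_cancel_left_pos)
  qed
  have "2 * t * ?E \<le> t\<^sup>2 * B + 4 * ?A" if t: "t > 0" for t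
  proof -
    let ?s = "\<lambda>n. 1 / real (Suc n)"
    have "(\<lambda>n. t\<^sup>2 * B + (4 * ?A - 4 * ?s n * ?m + 2 * (?s n)\<^sup>2 * ?E)) \<longlonglongrightarrow> t\<^sup>2 * B + (4 * ?A - 4 * 0 * ?m + 2 * 0\<^sup>2 * ?E)"
      by (intro tendsto_intros LIMSEQ_Suc[OF lim_1_over_n])
    then have "2 * t * ?E \<le> t\<^sup>2 * B + (4 * ?A - 4 * 0 * ?m + 2 * 0\<^sup>2 * ?E)"
      by (rule LIMSEQ_le_const) (intro exI allI impI core t, simp)
    then show ?thesis by simp
  qed
  with B show ?thesis by (intro quadratic_bound) auto
qed

text \<open>With 0 times infinity equal to 0, an infinite factor helps only if the other is nonzero.
  If \<open>F\<close> is not 0, neither factor vanishes: \<open>?X = 0\<close> would make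
  \<open>f\<close> null, and \<open>?Y = 0\<close> would make \<open>g\<close> null, hence
  \<open>f\<close> by \<open>pl\<close>. Only then are the finite moments compared direction by
  direction.\<close>

lemma uncertainty_Borel:
  fixes f g :: "real ^ 3 \<Rightarrow> g3"
  assumes [measurable]: "f \<in> borel_measurable borel" "g \<in> borel_measurable borel"
    and fin: "(\<integral>\<^sup>+x. ennreal ((norm (f x))\<^sup>2) \<partial>lborel) < \<infinity>"
    and pl: "ennreal ((2 * pi) ^ 3) * (\<integral>\<^sup>+x. ennreal ((norm (f x))\<^sup>2) \<partial>lborel)
      \<le> (\<integral>\<^sup>+\<omega>. ennreal ((norm (g \<omega>))\<^sup>2) \<partial>lborel)"
    and pl_h: "\<And>h. ennreal ((2 * pi) ^ 3) * (\<integral>\<^sup>+x. ennreal ((norm (f (x + h) - f x))\<^sup>2) \<partial>lborel)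
      \<le> (\<integral>\<^sup>+\<omega>. ennreal ((norm (g \<omega> * exp_i3 (\<omega> \<bullet> h) - g \<omega>))\<^sup>2) \<partial>lborel)"
  shows "ennreal (3 * ((2 * pi) ^ 3 / 4)) * (\<integral>\<^sup>+x. ennreal ((norm (f x))\<^sup>2) \<partial>lborel)\<^sup>2
    \<le> (\<integral>\<^sup>+x. ennreal ((x \<bullet> x) * (norm (f x))\<^sup>2) \<partial>lborel)
      * (\<integral>\<^sup>+\<omega>. ennreal ((\<omega> \<bullet> \<omega>) * (norm (g \<omega>))\<^sup>2) \<partial>lborel)" (is "_ * ?F\<^sup>2 \<le> ?X * ?Y")
proof (cases "?F = 0")
  case False
  \<comment> \<open>A vanishing second moment forces \<open>u\<close> to vanish almost everywhere
    off the origin, and the origin is a null set.\<close>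
  have zero: "(\<integral>\<^sup>+x. ennreal ((norm (u x))\<^sup>2) \<partial>lborel) = 0"
    if [measurable]: "u \<in> borel_measurable borel"
      and "(\<integral>\<^sup>+x. ennreal ((x \<bullet> x) * (norm (u x))\<^sup>2) \<partial>lborel) = 0" for u :: "real ^ 3 \<Rightarrow> g3"
  proof -
    have "AE x in lborel. ennreal ((x \<bullet> x) * (norm (u x))\<^sup>2) = 0"
      using that by (subst (asm) nn_integral_0_iff_AE) auto
    then have "AE x in lborel. ennreal ((norm (u x))\<^sup>2) = 0"
      using AE_lborel_singleton[of "0 :: real ^ 3"]
    proof eventually_elim
      case (elim x)
      then have "(x \<bullet> x) * (norm (u x))\<^sup>2 \<le> 0" by (simp only: ennreal_eq_0_iff)
      moreover have "x \<bullet> x > 0" using elim by simp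
      ultimately have "(norm (u x))\<^sup>2 \<le> 0" by (simp add: mult_le_0_iff)
      then show ?case by (simp only: ennreal_eq_0_iff)
    qed
    then show ?thesis by (subst nn_integral_0_iff_AE) auto
  qed
  have X0: "?X \<noteq> 0" using zero[of f] False by auto
  have Y0: "?Y \<noteq> 0"
  proof
    assume "?Y = 0"
    from zero[OF assms(2) this] pl have "ennreal ((2 * pi) ^ 3) * ?F = 0" by simp
    then show False using False by simp
  qed
  show ?thesis
  proof (cases "?X = \<infinity> \<or> ?Y = \<infinity>")
    case True
    then have "?X * ?Y = \<infinity>" using X0 Y0 by (auto simp: ennreal_mult_eq_top_iff)
    then show ?thesis by simp
  next
    case finXY: False
    let ?E = "LINT x|lborel. (norm (f x))\<^sup>2"
    let ?X' = "LINT x|lborel. (x \<bullet> x) * (norm (f x))\<^sup>2"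
    let ?Y' = "LINT x|lborel. (x \<bullet> x) * (norm (g x))\<^sup>2"
    define A where "A b = (LINT x|lborel. (x \<bullet> b)\<^sup>2 * (norm (f x))\<^sup>2)" for b
    define B where "B b = (LINT x|lborel. (x \<bullet> b)\<^sup>2 * (norm (g x))\<^sup>2)" for b
    have int_f: "integrable lborel (\<lambda>x. (norm (f x))\<^sup>2)"
      by (rule square_integrable_Borel[OF _ fin]) simp
    have int_X: "integrable lborel (\<lambda>x. (x \<bullet> x) * (norm (f x))\<^sup>2)"
      and int_Y: "integrable lborel (\<lambda>x. (x \<bullet> x) * (norm (g x))\<^sup>2)"
      using finXY by (auto intro!: integrableI_bounded simp: less_top)
    have comp: "integrable lborel (\<lambda>x. (x \<bullet> b)\<^sup>2 * (norm (u x))\<^sup>2)"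
      if b: "b \<in> Basis" and [measurable]: "u \<in> borel_measurable borel"
        and int: "integrable lborel (\<lambda>x. (x \<bullet> x) * (norm (u x))\<^sup>2)" for b :: "real ^ 3" and u :: "real ^ 3 \<Rightarrow> g3"
    proof (rule Bochner_Integration.integrable_bound[OF int])
      have "(x \<bullet> b)\<^sup>2 \<le> x \<bullet> x" for x
        using Cauchy_Schwarz_ineq[of x b] b by (simp add: inner_Basis)
      then show "AE x in lborel. norm ((x \<bullet> b)\<^sup>2 * (norm (u x))\<^sup>2) \<le> norm ((x \<bullet> x) * (norm (u x))\<^sup>2)"
        by (auto intro!: mult_right_mono)
    qed measurable
    have sum_comp: "(LINT x|lborel. (x \<bullet> x) * (norm (u x))\<^sup>2) = (\<Sum>b\<in>Basis. LINT x|lborel. (x \<bullet> b)\<^sup>2 * (norm (u x))\<^sup>2)"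
      if [measurable]: "u \<in> borel_measurable borel"
        and int: "integrable lborel (\<lambda>x. (x \<bullet> x) * (norm (u x))\<^sup>2)" for u :: "real ^ 3 \<Rightarrow> g3"
    proof -
      have "x \<bullet> x = (\<Sum>b\<in>Basis. (x \<bullet> b)\<^sup>2)" for x :: "real ^ 3"
        by (subst euclidean_inner) (simp add: power2_eq_square)
      then have "(LINT x|lborel. (x \<bullet> x) * (norm (u x))\<^sup>2) = (LINT x|lborel. (\<Sum>b\<in>Basis. (x \<bullet> b)\<^sup>2 * (norm (u x))\<^sup>2))"
        by (simp add: sum_distrib_right)
      also have "\<dots> = (\<Sum>b\<in>Basis. LINT x|lborel. (x \<bullet> b)\<^sup>2 * (norm (u x))\<^sup>2)"
        by (intro Bochner_Integration.integral_sum comp that)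
      finally show ?thesis .
    qed
    have dir: "?E\<^sup>2 \<le> 4 * A b * (B b / (2 * pi) ^ 3)" if b: "b \<in> Basis" for b
      unfolding A_def
    proof (rule directional_uncertainty[OF assms(1) _ int_f comp[OF b assms(1) int_X]])
      show "norm b = 1" using b by simp
      show "B b / (2 * pi) ^ 3 \<ge> 0" by (simp add: B_def)
      fix s
      let ?D = "\<integral>\<^sup>+x. ennreal ((norm (f (x + s *\<^sub>R b) - f x))\<^sup>2) \<partial>lborel"
      have "ennreal ((2 * pi) ^ 3) * ?D \<le> (\<integral>\<^sup>+\<omega>. ennreal ((norm (g \<omega> * exp_i3 (\<omega> \<bullet> (s *\<^sub>R b)) - g \<omega>))\<^sup>2) \<partial>lborel)"
        by (rule pl_h)
      also have "\<dots> \<le> (\<integral>\<^sup>+\<omega>. ennreal (s\<^sup>2 * ((\<omega> \<bullet> b)\<^sup>2 * (norm (g \<omega>))\<^sup>2)) \<partial>lborel)"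
        using norm_mult_exp_i3_diff_le
        by (intro nn_integral_mono ennreal_leI) (metis inner_scaleR_right power_mult_distrib mult.assoc)
      also have "\<dots> = ennreal (s\<^sup>2 * B b)"
        unfolding B_def using comp[OF b assms(2) int_Y]
        by (subst nn_integral_eq_integral) auto
      finally have le: "ennreal ((2 * pi) ^ 3) * ?D \<le> ennreal (s\<^sup>2 * B b)" .
      have "?D = ennreal (1 / (2 * pi) ^ 3) * (ennreal ((2 * pi) ^ 3) * ?D)"
        by (simp flip: mult.assoc ennreal_mult)
      also have "\<dots> \<le> ennreal (1 / (2 * pi) ^ 3) * ennreal (s\<^sup>2 * B b)"
        using le by (rule mult_left_mono) simp
      also have "\<dots> = ennreal (s\<^sup>2 * (B b / (2 * pi) ^ 3))"
        by (simp flip: ennreal_mult')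
      finally show "?D \<le> ennreal (s\<^sup>2 * (B b / (2 * pi) ^ 3))" .
    qed
    have nonneg: "A b \<ge> 0" "B b \<ge> 0" for b by (simp_all add: A_def B_def)
    have "3 * ?E\<^sup>2 = (\<Sum>b\<in>(Basis :: (real ^ 3) set). ?E\<^sup>2)" by simp
    also have "\<dots> \<le> (\<Sum>b\<in>Basis. 4 / (2 * pi) ^ 3 * (A b * B b))"
      using dir by (intro sum_mono) (simp add: field_simps)
    also have "\<dots> = 4 / (2 * pi) ^ 3 * (\<Sum>b\<in>Basis. A b * B b)"
      by (simp only: sum_distrib_left)
    \<comment> \<open>Each directional moment of \<open>f\<close> is enlarged to the full one, which
      drops the nonnegative cross terms of the product of the two sums.\<close>
    also have "\<dots> \<le> 4 / (2 * pi) ^ 3 * (\<Sum>b\<in>Basis. ?X' * B b)"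
    proof (intro mult_left_mono sum_mono mult_right_mono nonneg)
      fix b :: "real ^ 3" assume "b \<in> Basis"
      then have "A b \<le> (\<Sum>b\<in>Basis. A b)" using nonneg by (intro member_le_sum) auto
      then show "A b \<le> ?X'" using sum_comp[OF assms(1) int_X] by (simp add: A_def)
    qed simp
    also have "(\<Sum>b\<in>Basis. ?X' * B b) = ?X' * ?Y'"
      using sum_comp[OF assms(2) int_Y] by (simp add: B_def sum_distrib_left)
    finally have real_le: "3 * ((2 * pi) ^ 3 / 4) * ?E\<^sup>2 \<le> ?X' * ?Y'"
      by (simp add: field_simps)
    have "?F = ennreal ?E" "?X = ennreal ?X'" "?Y = ennreal ?Y'"
      by (auto intro!: nn_integral_eq_integral int_f int_X int_Y)
    then show ?thesis
      using real_le by (simp add: ennreal_power ennreal_leI flip: ennreal_mult ennreal_mult')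
  qed
qed simp

theorem theorem5p3:
  fixes f g :: "real ^ 3 \<Rightarrow> g3" and F :: ennreal
  assumes "has_cft f g"
    and "(\<integral>\<^sup>+x. ennreal ((norm (f x))\<^sup>2) \<partial>lebesgue) = F"
    and "F < \<infinity>"
  shows "(\<integral>\<^sup>+x. ennreal ((x \<bullet> x) * (norm (f x))\<^sup>2) \<partial>lebesgue)
         * (\<integral>\<^sup>+\<omega>. ennreal ((\<omega> \<bullet> \<omega>) * (norm (g \<omega>))\<^sup>2) \<partial>lebesgue)
         \<ge> ennreal (3 * ((2 * pi) ^ 3 / 4)) * F\<^sup>2"
proof -
  have fin: "(\<integral>\<^sup>+x. ennreal ((norm (f x))\<^sup>2) \<partial>lebesgue) < \<infinity>"
    using assms(2,3) by simp
  obtain f' g' where [measurable]: "f' \<in> borel_measurable borel" "g' \<in> borel_measurable borel"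
    and eq: "AE x in lborel. f x = f' x" "AE x in lborel. g x = g' x"
    and pl: "ennreal ((2 * pi) ^ 3) * (\<integral>\<^sup>+x. ennreal ((norm (f' x))\<^sup>2) \<partial>lborel)
      \<le> (\<integral>\<^sup>+\<omega>. ennreal ((norm (g' \<omega>))\<^sup>2) \<partial>lborel)"
    "\<And>h. ennreal ((2 * pi) ^ 3) * (\<integral>\<^sup>+x. ennreal ((norm (f' (x + h) - f' x))\<^sup>2) \<partial>lborel)
      \<le> (\<integral>\<^sup>+\<omega>. ennreal ((norm (g' \<omega> * exp_i3 (\<omega> \<bullet> h) - g' \<omega>))\<^sup>2) \<partial>lborel)"
    by (rule has_cft_plancherel[OF assms(1) fin]) (rule that)
  \<comment> \<open>The three integrals ignore null sets, so they may be computed from the Borel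
    representatives.\<close>
  have F: "F = (\<integral>\<^sup>+x. ennreal ((norm (f' x))\<^sup>2) \<partial>lborel)"
    unfolding assms(2)[symmetric] nn_integral_completion
    using eq(1) by (intro nn_integral_cong_AE) (auto elim: eventually_mono)
  have X: "(\<integral>\<^sup>+x. ennreal ((x \<bullet> x) * (norm (f x))\<^sup>2) \<partial>lebesgue) = (\<integral>\<^sup>+x. ennreal ((x \<bullet> x) * (norm (f' x))\<^sup>2) \<partial>lborel)"
    unfolding nn_integral_completion
    using eq(1) by (intro nn_integral_cong_AE) (auto elim: eventually_mono)
  have Y: "(\<integral>\<^sup>+x. ennreal ((x \<bullet> x) * (norm (g x))\<^sup>2) \<partial>lebesgue) = (\<integral>\<^sup>+x. ennreal ((x \<bullet> x) * (norm (g' x))\<^sup>2) \<partial>lborel)"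
    unfolding nn_integral_completion
    using eq(2) by (intro nn_integral_cong_AE) (auto elim: eventually_mono)
  show ?thesis
    unfolding F X Y using assms(3) pl by (intro uncertainty_Borel) (simp_all add: F)
qed

end
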